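(* For each integer $d\ge 2$, let $I_Q^d$ denote the minimal value (infimum), over all quantum behaviors $\mathbb{P}_Q$ in the $2\times 2\times d$ Bell setting (with no restriction on the Hilbert spaces, the state, or the measurement operators), of the quantity $$\mathbb{P}_Q(A_2<B_2)+\mathbb{P}_Q(B_2<A_1)+\mathbb{P}_Q(A_1<B_1)+\mathbb{P}_Q(B_1\le A_2).$$ Then $$\lim_{d\to\infty} I_Q^d = 0 .$$ Hence the inequality $$\mathbb{P}_Q(A_2<B_2)+\mathbb{P}_Q(B_2<A_1)+\mathbb{P}_Q(A_1<B_1)+\mathbb{P}_Q(B_1\le A_2)\ \ge\ 0$$ is a tight quantum Bell inequality for the $2\times2\times\infty$ Bell setting (the limit $d\to\infty$ of infinitely many outcomes): it holds for all quantum behaviors, and the constant $0$ on the right-hand side cannot be replaced by any larger constant.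
   Context: In the $2\times2\times d$ Bell setting, two parties, Alice and Bob, each choose one of two measurements (labelled $a\in\{1,2\}$ for Alice, $b\in\{1,2\}$ for Bob), and each measurement has $d$ possible outcomes, labelled $0,1,\dots,d-1$. A quantum behavior in this setting is a family of joint outcome probabilities of the form $$\mathbb{P}_Q(k,l\mid a,b)=\mathrm{Tr}\big((A_a^k\otimes B_b^l)\,\rho\big),\qquad k,l\in\{0,\dots,d-1\},\ a,b\in\{1,2\},$$ where $\mathcal H_A,\mathcal H_B$ are complex Hilbert spaces (arbitrary), $\rho$ is a density matrix (positive trace-one operator) on $\mathcal H_A\otimes\mathcal H_B$, and $A_a^k$ on $\mathcal H_A$ and $B_b^l$ on $\mathcal H_B$ are positive operators with $\sum_{k=0}^{d-1}A_a^k=\mathbf 1$ for each $a$ and $\sum_{l=0}^{d-1}B_b^l=\mathbf 1$ for each $b$. Notation: $k$ is Alice's outcome and $l$ is Bob's outcome, and $$\mathbb{P}_Q(A_a<B_b)=\sum_{k<l}\mathbb{P}_Q(k,l\mid a,b),\quad \mathbb{P}_Q(B_b<A_a)=\sum_{l<k}\mathbb{P}_Q(k,l\mid a,b),\quad \mathbb{P}_Q(B_b\le A_a)=\sum_{l\le k}\mathbb{P}_Q(k,l\mid a,b).$$ The $2\times2\times\infty$ Bell setting refers to the case of infinitely many outcomes, obtained as the limit $d\to\infty$; a lower bound there is called tight if it equals the limit as $d\to\infty$ of the minimal values over $2\times 2\times d$ quantum behaviors. *)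

theory Defs
  imports "HOL-Analysis.Analysis"
begin

text \<open>
  The infimum in the theorem ranges over all Hilbert spaces, which HOL cannot express by
  quantifying over types. A complex Hilbert space is therefore a pair \<open>(V, ip)\<close>: a linear
  subspace \<open>V\<close> of an ambient complex vector space, together with an arbitrary inner product
  \<open>ip\<close> on \<open>V\<close> for which \<open>V\<close> is complete. The ambient space has no inner product and only
  plays the role of a universe: any given Hilbert spaces \<open>H_A\<close>, \<open>H_B\<close>, \<open>H_A \<otimes> H_B\<close> are of
  this form, for instance inside their algebraic direct sum. Values of operators and inner
  products outside the carriers are irrelevant.
\<close>

locale complex_vector_space = vector_space scale
  for scale :: "complex \<Rightarrow> 'v::ab_group_add \<Rightarrow> 'v" (infixr "*C" 75)
begin

definition inner_product_on :: "'v set \<Rightarrow> ('v \<Rightarrow> 'v \<Rightarrow> complex) \<Rightarrow> bool" where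
  \<comment> \<open>linear in the second argument\<close>
  "inner_product_on V ip \<longleftrightarrow>
     (\<forall>x\<in>V. \<forall>y\<in>V. \<forall>z\<in>V. ip x (y + z) = ip x y + ip x z) \<and>
     (\<forall>x\<in>V. \<forall>y\<in>V. \<forall>c. ip x (c *C y) = c * ip x y) \<and>
     (\<forall>x\<in>V. \<forall>y\<in>V. ip y x = cnj (ip x y)) \<and>
     (\<forall>x\<in>V. x \<noteq> 0 \<longrightarrow> Re (ip x x) > 0)"

definition hnorm :: "('v \<Rightarrow> 'v \<Rightarrow> complex) \<Rightarrow> 'v \<Rightarrow> real" where
  "hnorm ip x = sqrt (Re (ip x x))"

definition hilbert_space :: "'v set \<Rightarrow> ('v \<Rightarrow> 'v \<Rightarrow> complex) \<Rightarrow> bool" where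
  "hilbert_space V ip \<longleftrightarrow>
     subspace V \<and> inner_product_on V ip \<and>
     (\<forall>X :: nat \<Rightarrow> 'v.
        (\<forall>n. X n \<in> V) \<and> (\<forall>e>0. \<exists>N. \<forall>m\<ge>N. \<forall>n\<ge>N. hnorm ip (X m - X n) < e) \<longrightarrow>
        (\<exists>L\<in>V. (\<lambda>n. hnorm ip (X n - L)) \<longlonglongrightarrow> 0))"

definition dense_span :: "'v set \<Rightarrow> ('v \<Rightarrow> 'v \<Rightarrow> complex) \<Rightarrow> 'v set \<Rightarrow> bool" where
  "dense_span V ip S \<longleftrightarrow> S \<subseteq> V \<and> (\<forall>x\<in>V. \<forall>e>0. \<exists>y\<in>span S. hnorm ip (x - y) < e)"

definition orthonormal_basis :: "'v set \<Rightarrow> ('v \<Rightarrow> 'v \<Rightarrow> complex) \<Rightarrow> 'v set \<Rightarrow> bool" where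
  "orthonormal_basis V ip E \<longleftrightarrow>
     (\<forall>e\<in>E. \<forall>f\<in>E. ip e f = (if e = f then 1 else 0)) \<and> dense_span V ip E"

definition bounded_operator :: "'v set \<Rightarrow> ('v \<Rightarrow> 'v \<Rightarrow> complex) \<Rightarrow> ('v \<Rightarrow> 'v) \<Rightarrow> bool" where
  "bounded_operator V ip T \<longleftrightarrow>
     (\<forall>x\<in>V. T x \<in> V) \<and>
     (\<forall>x\<in>V. \<forall>y\<in>V. T (x + y) = T x + T y) \<and>
     (\<forall>x\<in>V. \<forall>c. T (c *C x) = c *C T x) \<and>
     (\<exists>K. \<forall>x\<in>V. hnorm ip (T x) \<le> K * hnorm ip x)"

definition positive_operator :: "'v set \<Rightarrow> ('v \<Rightarrow> 'v \<Rightarrow> complex) \<Rightarrow> ('v \<Rightarrow> 'v) \<Rightarrow> bool" where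
  "positive_operator V ip T \<longleftrightarrow>
     bounded_operator V ip T \<and> (\<forall>x\<in>V. ip x (T x) \<in> \<real> \<and> Re (ip x (T x)) \<ge> 0)"

text \<open>
  A bounded operator is trace class iff the sum below converges unconditionally for every
  orthonormal basis; its value is then independent of the basis.
\<close>

definition has_trace ::
  "'v set \<Rightarrow> ('v \<Rightarrow> 'v \<Rightarrow> complex) \<Rightarrow> ('v \<Rightarrow> 'v) \<Rightarrow> complex \<Rightarrow> bool" where
  "has_trace V ip T t \<longleftrightarrow>
     (\<forall>E. orthonormal_basis V ip E \<longrightarrow> ((\<lambda>e. ip e (T e)) has_sum t) E)"

definition density_operator :: "'v set \<Rightarrow> ('v \<Rightarrow> 'v \<Rightarrow> complex) \<Rightarrow> ('v \<Rightarrow> 'v) \<Rightarrow> bool" where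
  "density_operator V ip \<rho> \<longleftrightarrow> positive_operator V ip \<rho> \<and> has_trace V ip \<rho> 1"

text \<open>
  \<open>(V, ip)\<close> with the bilinear map \<open>\<tau>\<close>, written \<open>\<tau> x y = x \<otimes> y\<close>, is the Hilbert space tensor
  product, i.e. the completion of the algebraic tensor product for the inner product
  determined on elementary tensors. This fixes it up to a unitary compatible with \<open>\<tau>\<close>.
\<close>

definition tensor_product ::
  "'v set \<Rightarrow> ('v \<Rightarrow> 'v \<Rightarrow> complex) \<Rightarrow> 'v set \<Rightarrow> ('v \<Rightarrow> 'v \<Rightarrow> complex) \<Rightarrow>
   'v set \<Rightarrow> ('v \<Rightarrow> 'v \<Rightarrow> complex) \<Rightarrow> ('v \<Rightarrow> 'v \<Rightarrow> 'v) \<Rightarrow> bool" where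
  "tensor_product VA ipA VB ipB V ip \<tau> \<longleftrightarrow>
     hilbert_space V ip \<and>
     (\<forall>x\<in>VA. \<forall>x'\<in>VA. \<forall>y\<in>VB. \<tau> (x + x') y = \<tau> x y + \<tau> x' y) \<and>
     (\<forall>x\<in>VA. \<forall>y\<in>VB. \<forall>y'\<in>VB. \<tau> x (y + y') = \<tau> x y + \<tau> x y') \<and>
     (\<forall>x\<in>VA. \<forall>y\<in>VB. \<forall>c. \<tau> (c *C x) y = c *C \<tau> x y \<and> \<tau> x (c *C y) = c *C \<tau> x y) \<and>
     (\<forall>x\<in>VA. \<forall>x'\<in>VA. \<forall>y\<in>VB. \<forall>y'\<in>VB. ip (\<tau> x y) (\<tau> x' y') = ipA x x' * ipB y y') \<and>
     dense_span V ip {\<tau> x y | x y. x \<in> VA \<and> y \<in> VB}"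

text \<open>\<open>C\<close> is \<open>S \<otimes> T\<close>: by boundedness and density it is determined on \<open>V\<close>.\<close>

definition tensor_operator ::
  "'v set \<Rightarrow> 'v set \<Rightarrow> 'v set \<Rightarrow> ('v \<Rightarrow> 'v \<Rightarrow> complex) \<Rightarrow> ('v \<Rightarrow> 'v \<Rightarrow> 'v) \<Rightarrow>
   ('v \<Rightarrow> 'v) \<Rightarrow> ('v \<Rightarrow> 'v) \<Rightarrow> ('v \<Rightarrow> 'v) \<Rightarrow> bool" where
  "tensor_operator VA VB V ip \<tau> S T C \<longleftrightarrow>
     bounded_operator V ip C \<and> (\<forall>x\<in>VA. \<forall>y\<in>VB. C (\<tau> x y) = \<tau> (S x) (T y))"

definition measurement ::
  "nat \<Rightarrow> 'v set \<Rightarrow> ('v \<Rightarrow> 'v \<Rightarrow> complex) \<Rightarrow> (nat \<Rightarrow> 'v \<Rightarrow> 'v) \<Rightarrow> bool" where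
  "measurement d V ip M \<longleftrightarrow>
     (\<forall>k<d. positive_operator V ip (M k)) \<and> (\<forall>x\<in>V. (\<Sum>k<d. M k x) = x)"

text \<open>
  \<open>P k l a b\<close> is the probability of outcomes \<open>k\<close> (Alice) and \<open>l\<close> (Bob) for settings \<open>a\<close>, \<open>b\<close>;
  only \<open>k, l < d\<close> and \<open>a, b \<in> {1, 2}\<close> matter.
\<close>

definition quantum_behavior :: "nat \<Rightarrow> (nat \<Rightarrow> nat \<Rightarrow> nat \<Rightarrow> nat \<Rightarrow> real) \<Rightarrow> bool" where
  "quantum_behavior d P \<longleftrightarrow>
     (\<exists>VA ipA VB ipB V ip \<tau> \<rho> A B.
        hilbert_space VA ipA \<and> hilbert_space VB ipB \<and>
        tensor_product VA ipA VB ipB V ip \<tau> \<and>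
        density_operator V ip \<rho> \<and>
        (\<forall>a\<in>{1, 2}. measurement d VA ipA (A a)) \<and>
        (\<forall>b\<in>{1, 2}. measurement d VB ipB (B b)) \<and>
        (\<forall>a\<in>{1, 2}. \<forall>b\<in>{1, 2}. \<forall>k<d. \<forall>l<d.
           \<exists>C. tensor_operator VA VB V ip \<tau> (A a k) (B b l) C \<and>
               has_trace V ip (\<lambda>x. C (\<rho> x)) (complex_of_real (P k l a b))))"

end

definition prob_A_less_B ::
  "nat \<Rightarrow> (nat \<Rightarrow> nat \<Rightarrow> nat \<Rightarrow> nat \<Rightarrow> real) \<Rightarrow> nat \<Rightarrow> nat \<Rightarrow> real" where
  "prob_A_less_B d P a b = (\<Sum>(k, l) \<in> {(k, l). k < d \<and> l < d \<and> k < l}. P k l a b)"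

definition prob_B_less_A ::
  "nat \<Rightarrow> (nat \<Rightarrow> nat \<Rightarrow> nat \<Rightarrow> nat \<Rightarrow> real) \<Rightarrow> nat \<Rightarrow> nat \<Rightarrow> real" where
  "prob_B_less_A d P b a = (\<Sum>(k, l) \<in> {(k, l). k < d \<and> l < d \<and> l < k}. P k l a b)"

definition prob_B_le_A ::
  "nat \<Rightarrow> (nat \<Rightarrow> nat \<Rightarrow> nat \<Rightarrow> nat \<Rightarrow> real) \<Rightarrow> nat \<Rightarrow> nat \<Rightarrow> real" where
  "prob_B_le_A d P b a = (\<Sum>(k, l) \<in> {(k, l). k < d \<and> l < d \<and> l \<le> k}. P k l a b)"

definition bell_value :: "nat \<Rightarrow> (nat \<Rightarrow> nat \<Rightarrow> nat \<Rightarrow> nat \<Rightarrow> real) \<Rightarrow> real" where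
  "bell_value d P =
     prob_A_less_B d P 2 2 + prob_B_less_A d P 2 1 + prob_A_less_B d P 1 1 + prob_B_le_A d P 1 2"

definition (in complex_vector_space) quantum_min :: "nat \<Rightarrow> real" where
  "quantum_min d = Inf {bell_value d P | P. quantum_behavior d P}"

end

theory Submission
  imports Defs
begin

text \<open>
  Lower bound: the probabilities are traces of products of positive operators, hence
  nonnegative. Schur's product theorem makes \<open>A \<otimes> B\<close> positive, and applied to finite sections
  of an orthonormal basis it also shows that the trace of a product of positive operators is
  nonnegative, without square roots or the spectral theorem.

  Upper bound: take \<open>\<psi> = \<Sum>\<^sub>j \<alpha>\<^sub>j |j j\<rangle>\<close> in dimension \<open>d\<close> and measure in Fourier bases shifted by
  \<open>0, 1/2\<close> for Alice and \<open>1/4, -1/4\<close> for Bob. The Bell expression is then exactly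
  \<open>2 |\<alpha>|\<^sup>2 - (1/d) \<Sum>\<^sub>i\<^sub>j \<alpha>\<^sub>i \<alpha>\<^sub>j / cos (\<pi> (i - j) / (2 d))\<close>. The kernel is largest where \<open>i\<close> and \<open>j\<close> are
  near opposite ends of the range, and there it is \<open>2/\<pi>\<close> times the Hilbert matrix
  \<open>1 / (p + q)\<close>. Since the Hilbert matrix has norm \<open>\<pi>\<close>, approached by the vectors
  \<open>1 / sqrt p\<close> for \<open>p \<le> n\<close>, the value tends to \<open>2 - (2/\<pi>) \<pi> = 0\<close>.
\<close>

section \<open>Positive semidefinite matrices\<close>

text \<open>The obstacle in the lower bound is that \<open>C (\<rho> x)\<close> need not define a
  self-adjoint operator, so its diagonal entries have no sign, and expanding \<open>\<rho> e\<close>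
  along the basis turns a finite partial sum of them into a rectangular piece of the Schur sum, not
  a square one. Such a piece is nonnegative only up to an error. The error is at most a constant
  times the part of the trace of \<open>\<rho>\<close> that lies outside the finite set, and this
  part tends to 0. In the upper bound the Hilbert matrix approaches its norm only logarithmically:
  with \<open>n = d div 2\<close> the value is at most \<open>20 / (pi * harm n)\<close>, so the
  convergence to 0 that is proved here has rate 1 / log d. One fixed ambient space serves as
  universe for all d. It has to contain spaces of dimension d and d * d for every d, hence the
  hypothesis that no finite set spans it.\<close>

definition psd_matrix_on :: "'i set \<Rightarrow> ('i \<Rightarrow> 'i \<Rightarrow> complex) \<Rightarrow> bool" where
  "psd_matrix_on I M \<longleftrightarrow> (\<forall>c. (\<Sum>i\<in>I. \<Sum>j\<in>I. cnj (c i) * c j * M i j) \<in> \<real>\<^sub>\<ge>\<^sub>0)"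

lemma psd_matrix_on_subset:
  assumes "psd_matrix_on J M" "I \<subseteq> J" "finite J"
  shows "psd_matrix_on I M"
  unfolding psd_matrix_on_def
proof
  fix c :: "'a \<Rightarrow> complex"
  define c' where "c' i = (if i \<in> I then c i else 0)" for i
  have "(\<Sum>i\<in>I. \<Sum>j\<in>I. cnj (c i) * c j * M i j) = (\<Sum>i\<in>J. \<Sum>j\<in>J. cnj (c' i) * c' j * M i j)"
    using assms(2,3) by (intro sum.mono_neutral_cong_left) (auto simp: c'_def intro!: sum.mono_neutral_cong_left)
  then show "(\<Sum>i\<in>I. \<Sum>j\<in>I. cnj (c i) * c j * M i j) \<in> \<real>\<^sub>\<ge>\<^sub>0"
    using assms(1) by (simp add: psd_matrix_on_def)
qed

lemma psd_matrix_on_diag: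
  assumes "psd_matrix_on I M" "i \<in> I" "finite I"
  shows "M i i \<in> \<real>\<^sub>\<ge>\<^sub>0"
proof -
  have "psd_matrix_on {i} M"
    using assms(2,3) by (intro psd_matrix_on_subset[OF assms(1)]) auto
  from this[unfolded psd_matrix_on_def, rule_format, of "\<lambda>_. 1"]
  show ?thesis by simp
qed

lemma psd_matrix_on_pair:
  assumes "psd_matrix_on I M" "i \<in> I" "j \<in> I" "i \<noteq> j" "finite I"
  shows "cnj x * x * M i i + cnj x * y * M i j + cnj y * x * M j i + cnj y * y * M j j \<in> \<real>\<^sub>\<ge>\<^sub>0"
proof -
  have "psd_matrix_on {i,j} M"
    using assms(2,3,5) by (intro psd_matrix_on_subset[OF assms(1)]) auto
  from this[unfolded psd_matrix_on_def, rule_format, of "\<lambda>k. if k = i then x else y"]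
  show ?thesis using assms(4) by (simp add: add_ac)
qed

text \<open>Over the complex numbers real values of the form already force symmetry: the weights (1,
  1) settle the imaginary part of \<open>M i j\<close>, and (1, i) the real part.\<close>

lemma psd_matrix_on_hermitian:
  assumes "psd_matrix_on I M" "i \<in> I" "j \<in> I" "finite I"
  shows "M j i = cnj (M i j)"
proof (cases "i = j")
  case True
  then show ?thesis using psd_matrix_on_diag[OF assms(1,2,4)]
    by (auto simp: complex_nonneg_Reals_iff complex_eq_iff)
next
  case False
  note p = psd_matrix_on_pair[OF assms(1-3) False assms(4)]
  show ?thesis
    using p[of 1 1] p[of 1 \<i>] psd_matrix_on_diag[OF assms(1,2,4)] psd_matrix_on_diag[OF assms(1,3,4)]
    by (auto simp: complex_nonneg_Reals_iff complex_eq_iff)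
qed

text \<open>When \<open>M j j = 0\<close>, the form at the weights \<open>1\<close> and
  \<open>- t * cnj (M i j)\<close> is affine in the real parameter t with slope
  \<open>- 2 * (cmod (M i j))\<^sup>2\<close>. It stays nonnegative for all t, so the slope is
  0.\<close>

lemma psd_matrix_on_zero_diag:
  assumes "psd_matrix_on I M" "i \<in> I" "j \<in> I" "finite I" "M j j = 0"
  shows "M i j = 0"
proof (cases "i = j")
  case False
  define m where "m = (cmod (M i j))\<^sup>2"
  define r where "r = Re (M i i)"
  have h: "M j i = cnj (M i j)" by (rule psd_matrix_on_hermitian[OF assms(1-4)])
  have mm: "M i j * cnj (M i j) = of_real m" by (simp only: m_def complex_norm_square)
  have q: "0 \<le> r - 2 * t * m" for t :: real
  proof -
    have "Re (M i i - 2 * of_real t * (M i j * cnj (M i j))) \<ge> 0"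
      using psd_matrix_on_pair[OF assms(1-3) False assms(4), of 1 "- of_real t * cnj (M i j)"] assms(5) h
      by (simp add: complex_nonneg_Reals_iff algebra_simps)
    then show ?thesis by (simp add: mm r_def)
  qed
  have "m = 0"
  proof (rule ccontr)
    assume "m \<noteq> 0"
    then show False using q[of "(r + 1) / (2 * m)"] by simp
  qed
  then show ?thesis by (simp add: m_def)
qed (use assms in simp)

text \<open>A trace of a product pairs \<open>M i j\<close> with \<open>N j i\<close>, whereas the
  Schur sum pairs it with \<open>N i j\<close>; this lemma bridges the two.\<close>

lemma psd_matrix_on_transpose:
  assumes "psd_matrix_on I M"
  shows "psd_matrix_on I (\<lambda>i j. M j i)"
  unfolding psd_matrix_on_def
proof
  fix c :: "'a \<Rightarrow> complex"
  have "(\<Sum>i\<in>I. \<Sum>j\<in>I. cnj (cnj (c i)) * cnj (c j) * M i j) \<in> \<real>\<^sub>\<ge>\<^sub>0"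
    using assms[unfolded psd_matrix_on_def, rule_format, of "\<lambda>i. cnj (c i)"] .
  also have "(\<Sum>i\<in>I. \<Sum>j\<in>I. cnj (cnj (c i)) * cnj (c j) * M i j) =
      (\<Sum>i\<in>I. \<Sum>j\<in>I. cnj (c i) * c j * M j i)"
    by (subst sum.swap) (simp add: mult_ac)
  finally show "(\<Sum>i\<in>I. \<Sum>j\<in>I. cnj (c i) * c j * M j i) \<in> \<real>\<^sub>\<ge>\<^sub>0" .
qed

lemma psd_matrix_on_congruence:
  assumes "psd_matrix_on I M"
  shows "psd_matrix_on I (\<lambda>i j. cnj (a i) * a j * M i j)"
  unfolding psd_matrix_on_def
proof
  fix c :: "'a \<Rightarrow> complex"
  show "(\<Sum>i\<in>I. \<Sum>j\<in>I. cnj (c i) * c j * (cnj (a i) * a j * M i j)) \<in> \<real>\<^sub>\<ge>\<^sub>0"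
    using assms[unfolded psd_matrix_on_def, rule_format, of "\<lambda>i. a i * c i"]
    by (simp add: mult_ac)
qed

text \<open>Minimising the form of \<open>N\<close> on \<open>insert n I\<close> over the
  coefficient at \<open>n\<close> leaves exactly the form of the complement on
  \<open>I\<close>.\<close>

lemma psd_matrix_on_schur_complement:
  assumes "psd_matrix_on (insert n I) N" "n \<notin> I" "finite I"
  shows "psd_matrix_on I (\<lambda>i j. N i j - N i n * N n j / N n n)"
  unfolding psd_matrix_on_def
proof
  fix c :: "'a \<Rightarrow> complex"
  define s where "s = (\<Sum>j\<in>I. c j * N n j)"
  have fin: "finite (insert n I)" using assms(3) by simp
  have her: "N i n = cnj (N n i)" if "i \<in> I" for i
    using psd_matrix_on_hermitian[OF assms(1) _ _ fin, of n i] that by simp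
  have cs: "(\<Sum>i\<in>I. cnj (c i) * N i n) = cnj s"
    unfolding s_def by (simp add: her)
  have lhs: "(\<Sum>i\<in>I. \<Sum>j\<in>I. cnj (c i) * c j * (N i j - N i n * N n j / N n n)) =
     (\<Sum>i\<in>I. \<Sum>j\<in>I. cnj (c i) * c j * N i j) - cnj s * s / N n n"
  proof -
    have "(\<Sum>i\<in>I. \<Sum>j\<in>I. cnj (c i) * c j * (N i n * N n j / N n n)) = 
       (\<Sum>i\<in>I. cnj (c i) * N i n) * s / N n n"
      unfolding s_def sum_product by (simp add: sum_divide_distrib mult_ac)
    then show ?thesis
      by (simp add: right_diff_distrib sum_subtractf cs)
  qed
  show "(\<Sum>i\<in>I. \<Sum>j\<in>I. cnj (c i) * c j * (N i j - N i n * N n j / N n n)) \<in> \<real>\<^sub>\<ge>\<^sub>0"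
  \<comment> \<open>Division by 0 yields 0, so in the degenerate case the complement is
    \<open>N\<close> itself.\<close>
  proof (cases "N n n = 0")
    case True
    have "psd_matrix_on I N" using assms(3) by (intro psd_matrix_on_subset[OF assms(1)]) auto
    then show ?thesis unfolding lhs using True by (simp add: psd_matrix_on_def)
  next
    case False
    \<comment> \<open>The minimiser of the quadratic polynomial in the coefficient at
      \<open>n\<close>, found by completing the square.\<close>
    define t where "t = - s / N n n"
    have nn: "cnj (N n n) = N n n"
      using psd_matrix_on_hermitian[OF assms(1) _ _ fin, of n n] by simp
    define c' where "c' = c(n := t)"
    have c'I: "c' i = c i" if "i \<in> I" for i using that assms(2) by (auto simp: c'_def)
    have c'n: "c' n = t" by (simp add: c'_def)
    have "(\<Sum>i\<in>insert n I. \<Sum>j\<in>insert n I. cnj (c' i) * c' j * N i j) =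
       cnj t * t * N n n + cnj t * (\<Sum>j\<in>I. c j * N n j) + (t * (\<Sum>i\<in>I. cnj (c i) * N i n)
       + (\<Sum>i\<in>I. \<Sum>j\<in>I. cnj (c i) * c j * N i j))"
      using assms(2,3) by (simp add: c'I c'n sum.distrib sum_distrib_left mult_ac)
    also have "\<dots> = (\<Sum>i\<in>I. \<Sum>j\<in>I. cnj (c i) * c j * N i j) - cnj s * s / N n n"
      unfolding cs s_def[symmetric] using False by (simp add: t_def nn field_simps)
    finally show ?thesis
      using assms(1)[unfolded psd_matrix_on_def, rule_format, of c'] unfolding lhs by simp
  qed
qed

text \<open>
  Induction on the index set: splitting off index \<open>n\<close> writes \<open>N\<close> as a nonnegative rank one
  matrix plus a positive semidefinite matrix whose row and column \<open>n\<close> vanish.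
\<close>

theorem schur_product_sum:
  assumes "finite I" "psd_matrix_on I M" "psd_matrix_on I N"
  shows "(\<Sum>i\<in>I. \<Sum>j\<in>I. M i j * N i j) \<in> \<real>\<^sub>\<ge>\<^sub>0"
  using assms
proof (induction I arbitrary: N rule: finite_induct)
  case (insert n I)
  define N' where "N' i j = N i j - N i n * N n j / N n n" for i j
  have fin: "finite (insert n I)" using insert by simp
  have Npsd: "psd_matrix_on I N'"
    unfolding N'_def using insert by (intro psd_matrix_on_schur_complement)
  have Mpsd: "psd_matrix_on I M"
    using fin by (intro psd_matrix_on_subset[OF insert.prems(1)]) auto
  have IH: "(\<Sum>i\<in>I. \<Sum>j\<in>I. M i j * N' i j) \<in> \<real>\<^sub>\<ge>\<^sub>0"
    using insert.IH[OF Mpsd Npsd] .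
  have her: "N i n = cnj (N n i)" if "i \<in> insert n I" for i
    using psd_matrix_on_hermitian[OF insert.prems(2) _ _ fin, of n i] that by simp
  \<comment> \<open>Either the subtraction cancels row and column \<open>n\<close>, or
    \<open>N n n = 0\<close> and they vanish already by
    \<open>psd_matrix_on_zero_diag\<close>.\<close>
  have N'0: "N' i n = 0 \<and> N' n i = 0" if "i \<in> insert n I" for i
    using psd_matrix_on_zero_diag[OF insert.prems(2) that _ fin, of n] her[OF that]
    by (cases "N n n = 0") (auto simp: N'_def)
  have "(\<Sum>i\<in>insert n I. \<Sum>j\<in>insert n I. M i j * N' i j) = (\<Sum>i\<in>I. \<Sum>j\<in>I. M i j * N' i j)"
    using insert.hyps N'0 by simp
  moreover have "(\<Sum>i\<in>insert n I. \<Sum>j\<in>insert n I. M i j * (N i n * N n j / N n n)) \<in> \<real>\<^sub>\<ge>\<^sub>0"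
  proof -
    have "(\<Sum>i\<in>insert n I. \<Sum>j\<in>insert n I. M i j * (N i n * N n j / N n n)) =
      (\<Sum>i\<in>insert n I. \<Sum>j\<in>insert n I. cnj (N n i) * N n j * M i j) * inverse (N n n)"
      unfolding sum_distrib_right
      by (intro sum.cong refl, subst her) (simp_all only: divide_inverse mult_ac)
    moreover have "inverse (N n n) \<in> \<real>\<^sub>\<ge>\<^sub>0"
      using psd_matrix_on_diag[OF insert.prems(2) _ fin, of n] by (simp add: nonneg_Reals_inverse_I)
    ultimately show ?thesis
      using insert.prems(1)[unfolded psd_matrix_on_def, rule_format, of "N n"] nonneg_Reals_mult_I by simp
  qed
  moreover have "(\<Sum>i\<in>insert n I. \<Sum>j\<in>insert n I. M i j * N i j) =
      (\<Sum>i\<in>insert n I. \<Sum>j\<in>insert n I. M i j * N' i j) +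
      (\<Sum>i\<in>insert n I. \<Sum>j\<in>insert n I. M i j * (N i n * N n j / N n n))"
    unfolding N'_def sum.distrib[symmetric] by (intro sum.cong refl) (simp add: algebra_simps)
  ultimately show ?case using IH by (simp only: nonneg_Reals_add_I)
qed simp

section \<open>Inner product spaces and orthonormal bases\<close>

locale inner_product_space = complex_vector_space scale
  for scale :: "complex \<Rightarrow> 'v::ab_group_add \<Rightarrow> 'v" (infixr "*C" 75) +
  fixes V :: "'v set" and ip :: "'v \<Rightarrow> 'v \<Rightarrow> complex"
  assumes subspace_V: "subspace V" and inner_product_on_V: "inner_product_on V ip"
begin

abbreviation vnorm :: "'v \<Rightarrow> real" where "vnorm \<equiv> hnorm ip"

lemma V_closed [simp]:
  "0 \<in> V"
  "x \<in> V \<Longrightarrow> y \<in> V \<Longrightarrow> x + y \<in> V"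
  "x \<in> V \<Longrightarrow> y \<in> V \<Longrightarrow> x - y \<in> V"
  "x \<in> V \<Longrightarrow> c *C x \<in> V"
  "x \<in> V \<Longrightarrow> - x \<in> V"
  using subspace_V
  by (auto intro: subspace_0 subspace_add subspace_diff subspace_scale subspace_neg)

lemma V_sum [simp]: "(\<And>i. i \<in> I \<Longrightarrow> f i \<in> V) \<Longrightarrow> sum f I \<in> V"
  using subspace_V by (rule subspace_sum)

lemma ip_add_right [simp]: "x \<in> V \<Longrightarrow> y \<in> V \<Longrightarrow> z \<in> V \<Longrightarrow> ip x (y + z) = ip x y + ip x z"
  and ip_scale_right [simp]: "x \<in> V \<Longrightarrow> y \<in> V \<Longrightarrow> ip x (c *C y) = c * ip x y"
  and ip_commute: "x \<in> V \<Longrightarrow> y \<in> V \<Longrightarrow> ip y x = cnj (ip x y)"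
  and ip_pos: "x \<in> V \<Longrightarrow> x \<noteq> 0 \<Longrightarrow> Re (ip x x) > 0"
  using inner_product_on_V[unfolded inner_product_on_def, THEN conjunct1]
    inner_product_on_V[unfolded inner_product_on_def, THEN conjunct2, THEN conjunct1]
    inner_product_on_V[unfolded inner_product_on_def, THEN conjunct2, THEN conjunct2, THEN conjunct1]
    inner_product_on_V[unfolded inner_product_on_def, THEN conjunct2, THEN conjunct2, THEN conjunct2]
  by blast+

lemma ip_add_left [simp]: "x \<in> V \<Longrightarrow> y \<in> V \<Longrightarrow> z \<in> V \<Longrightarrow> ip (x + y) z = ip x z + ip y z"
  using ip_commute[of z "x + y"] ip_commute[of z x] ip_commute[of z y] by simp

lemma ip_scale_left [simp]: "x \<in> V \<Longrightarrow> y \<in> V \<Longrightarrow> ip (c *C x) y = cnj c * ip x y"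
  using ip_commute[of y "c *C x"] ip_commute[of y x] by simp

lemma ip_zero_right [simp]: "x \<in> V \<Longrightarrow> ip x 0 = 0"
  using ip_scale_right[of x 0 0] by simp

lemma ip_zero_left [simp]: "x \<in> V \<Longrightarrow> ip 0 x = 0"
  using ip_scale_left[of 0 x 0] by simp

lemma ip_diff_right [simp]: "x \<in> V \<Longrightarrow> y \<in> V \<Longrightarrow> z \<in> V \<Longrightarrow> ip x (y - z) = ip x y - ip x z"
  using ip_add_right[of x "y - z" z] by simp

lemma ip_diff_left [simp]: "x \<in> V \<Longrightarrow> y \<in> V \<Longrightarrow> z \<in> V \<Longrightarrow> ip (x - y) z = ip x z - ip y z"
  using ip_add_left[of "x - y" y z] by simp

lemma ip_sum_right:
  assumes "x \<in> V" "\<And>i. i \<in> I \<Longrightarrow> f i \<in> V"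
  shows "ip x (sum f I) = (\<Sum>i\<in>I. ip x (f i))"
  using assms by (induction I rule: infinite_finite_induct) auto

lemma ip_sum_left:
  assumes "x \<in> V" "\<And>i. i \<in> I \<Longrightarrow> f i \<in> V"
  shows "ip (sum f I) x = (\<Sum>i\<in>I. ip (f i) x)"
  using assms by (induction I rule: infinite_finite_induct) auto

lemma ip_self_nonneg: "x \<in> V \<Longrightarrow> Re (ip x x) \<ge> 0"
  using ip_pos[of x] by (cases "x = 0") auto

lemma vnorm_nonneg [simp]: "x \<in> V \<Longrightarrow> vnorm x \<ge> 0"
  by (simp add: hnorm_def ip_self_nonneg)

lemma vnorm_zero [simp]: "vnorm 0 = 0"
  by (simp add: hnorm_def)

lemma ip_self: "x \<in> V \<Longrightarrow> ip x x = of_real ((vnorm x)\<^sup>2)"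
  using ip_commute[of x x] by (simp add: hnorm_def ip_self_nonneg complex_eq_iff)

lemma vnorm_power2: "x \<in> V \<Longrightarrow> (vnorm x)\<^sup>2 = Re (ip x x)"
  by (simp add: hnorm_def ip_self_nonneg)

lemma vnorm_eq_zero: "x \<in> V \<Longrightarrow> vnorm x = 0 \<Longrightarrow> x = 0"
  using ip_pos[of x] by (auto simp: hnorm_def)

lemma vnorm_scale: "x \<in> V \<Longrightarrow> vnorm (c *C x) = cmod c * vnorm x"
proof -
  assume x: "x \<in> V"
  have "ip (c *C x) (c *C x) = of_real ((cmod c * vnorm x)\<^sup>2)"
    using x by (simp add: ip_self[OF x] power_mult_distrib mult_ac)
      (simp add: complex_norm_square flip: of_real_power)
  then have "vnorm (c *C x) = sqrt ((cmod c * vnorm x)\<^sup>2)"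
    by (simp add: hnorm_def[of _ "c *C x"] del: of_real_power of_real_mult)
  then show ?thesis
    using x by simp
qed

lemma pythagoras:
  assumes "x \<in> V" "y \<in> V" "ip x y = 0"
  shows "(vnorm (x + y))\<^sup>2 = (vnorm x)\<^sup>2 + (vnorm y)\<^sup>2"
  using assms ip_commute[of x y] by (simp add: vnorm_power2)

lemma vnorm_minus_commute: "x \<in> V \<Longrightarrow> y \<in> V \<Longrightarrow> vnorm (x - y) = vnorm (y - x)"
  using vnorm_scale[of "y - x" "-1"] by simp

lemma cauchy_schwarz:
  assumes "x \<in> V" "y \<in> V"
  shows "cmod (ip x y) \<le> vnorm x * vnorm y"
proof (cases "x = 0")
  case False
  define r where "r = Re (ip x x)"
  have r: "r > 0" "ip x x = of_real r"
    using ip_pos[OF assms(1) False] ip_self[OF assms(1)] by (auto simp: r_def)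
  define p where "p = (ip x y / of_real r) *C x"
  have p: "p \<in> V" using assms by (simp add: p_def)
  have "ip p (y - p) = 0"
    using assms r by (simp add: p_def)
  then have "(vnorm (p + (y - p)))\<^sup>2 = (vnorm p)\<^sup>2 + (vnorm (y - p))\<^sup>2"
    using assms p by (intro pythagoras) auto
  then have "(vnorm p)\<^sup>2 \<le> (vnorm y)\<^sup>2" by simp
  then have "vnorm p \<le> vnorm y"
    by (rule power2_le_imp_le) (simp add: assms)
  moreover have "vnorm p = cmod (ip x y) / r * vnorm x"
    using assms r by (simp add: p_def vnorm_scale norm_divide)
  moreover have "vnorm x * vnorm x = r"
    using vnorm_power2[OF assms(1)] by (simp add: r_def power2_eq_square)
  ultimately have "vnorm x * (cmod (ip x y) / r * vnorm x) \<le> vnorm x * vnorm y"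
    using assms by (intro mult_left_mono) auto
  moreover have "vnorm x * (cmod (ip x y) / r * vnorm x) = cmod (ip x y)"
    using \<open>vnorm x * vnorm x = r\<close> r by (simp add: field_simps)
  ultimately show ?thesis by simp
qed (use assms in simp)

lemma vnorm_triangle:
  assumes "x \<in> V" "y \<in> V"
  shows "vnorm (x + y) \<le> vnorm x + vnorm y"
proof (rule power2_le_imp_le)
  have "(vnorm (x + y))\<^sup>2 = (vnorm x)\<^sup>2 + 2 * Re (ip x y) + (vnorm y)\<^sup>2"
    using assms ip_commute[of x y] by (simp add: vnorm_power2)
  also have "\<dots> \<le> (vnorm x)\<^sup>2 + 2 * (vnorm x * vnorm y) + (vnorm y)\<^sup>2"
    using cauchy_schwarz[OF assms] complex_Re_le_cmod[of "ip x y"] by linarith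
  finally show "(vnorm (x + y))\<^sup>2 \<le> (vnorm x + vnorm y)\<^sup>2"
    by (simp add: power2_sum mult_ac)
qed (use assms in simp)

definition orthonormal :: "'v set \<Rightarrow> bool" where
  "orthonormal E \<longleftrightarrow> E \<subseteq> V \<and> (\<forall>e\<in>E. \<forall>f\<in>E. ip e f = (if e = f then 1 else 0))"

lemma orthonormal_basis_iff: "orthonormal_basis V ip E \<longleftrightarrow> orthonormal E \<and> dense_span V ip E"
  by (auto simp: orthonormal_basis_def orthonormal_def dense_span_def)

lemma orthonormal_subset: "orthonormal E \<Longrightarrow> F \<subseteq> E \<Longrightarrow> orthonormal F"
  unfolding orthonormal_def by blast

definition proj :: "'v set \<Rightarrow> 'v \<Rightarrow> 'v" where
  "proj G x = (\<Sum>e\<in>G. ip e x *C e)"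

lemma proj_in [simp]: "orthonormal G \<Longrightarrow> proj G x \<in> V"
  unfolding proj_def orthonormal_def by (intro V_sum V_closed) auto

lemma span_in: "G \<subseteq> V \<Longrightarrow> y \<in> span G \<Longrightarrow> y \<in> V"
  using span_minimal[OF _ subspace_V] by blast

lemma proj_in_span: "proj G x \<in> span G"
  unfolding proj_def by (intro span_sum span_scale span_base)

lemma ip_proj:
  assumes "orthonormal G" "finite G" "x \<in> V" "e \<in> G"
  shows "ip e (proj G x) = ip e x"
proof -
  have G: "G \<subseteq> V" using assms(1) by (simp add: orthonormal_def)
  have "ip e (proj G x) = (\<Sum>f\<in>G. ip f x * ip e f)"
    unfolding proj_def using assms subsetD[OF G] by (simp add: ip_sum_right)
  also have "\<dots> = (\<Sum>f\<in>G. if f = e then ip f x else 0)"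
    using assms(1,4) by (intro sum.cong) (auto simp: orthonormal_def)
  finally show ?thesis using assms by simp
qed

lemma ip_span_zero:
  assumes "G \<subseteq> V" "x \<in> V" "\<And>e. e \<in> G \<Longrightarrow> ip x e = 0" "y \<in> span G"
  shows "ip x y = 0"
proof -
  have "subspace {y \<in> V. ip x y = 0}"
    using assms(2) by (auto simp: subspace_def)
  then have "span G \<subseteq> {y \<in> V. ip x y = 0}"
    using assms by (intro span_minimal) auto
  then show ?thesis using assms(4) by blast
qed

lemma ip_residual_zero:
  assumes "orthonormal G" "finite G" "x \<in> V" "y \<in> span G"
  shows "ip (x - proj G x) y = 0"
proof (rule ip_span_zero[OF _ _ _ assms(4)])
  show G: "G \<subseteq> V" using assms(1) by (simp add: orthonormal_def)
  show "ip (x - proj G x) e = 0" if "e \<in> G" for e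
    using ip_proj[OF assms(1-3) that] G that assms
      ip_commute[of e x] ip_commute[of e "proj G x"] by auto
qed (use assms in auto)

lemma proj_best_approximation:
  assumes "orthonormal G" "finite G" "x \<in> V" "y \<in> span G"
  shows "vnorm (x - proj G x) \<le> vnorm (x - y)"
proof (rule power2_le_imp_le)
  have y: "y \<in> V" using assms span_in[of G y] by (auto simp: orthonormal_def)
  have "ip (x - proj G x) (proj G x - y) = 0"
    using assms by (intro ip_residual_zero span_diff proj_in_span)
  then have "(vnorm ((x - proj G x) + (proj G x - y)))\<^sup>2 =
      (vnorm (x - proj G x))\<^sup>2 + (vnorm (proj G x - y))\<^sup>2"
    using assms y by (intro pythagoras) auto
  then show "(vnorm (x - proj G x))\<^sup>2 \<le> (vnorm (x - y))\<^sup>2" by simp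
  show "0 \<le> vnorm (x - y)" using assms y by auto
qed

lemma proj_pythagoras:
  assumes "orthonormal G" "finite G" "x \<in> V"
  shows "(vnorm x)\<^sup>2 = (vnorm (x - proj G x))\<^sup>2 + (vnorm (proj G x))\<^sup>2"
  using pythagoras[of "x - proj G x" "proj G x"] assms ip_residual_zero[OF assms proj_in_span]
  by simp

lemma vnorm_proj_power2:
  assumes "orthonormal G" "finite G" "x \<in> V"
  shows "(vnorm (proj G x))\<^sup>2 = (\<Sum>e\<in>G. (cmod (ip e x))\<^sup>2)"
proof -
  have G: "G \<subseteq> V" using assms(1) by (simp add: orthonormal_def)
  have "ip (proj G x) (proj G x) = (\<Sum>e\<in>G. cnj (ip e x) * ip e (proj G x))"
    unfolding proj_def[of G x]
    by (subst ip_sum_left) (use G assms(3) in \<open>auto intro!: sum.cong simp flip: proj_def simp: assms(1)\<close>)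
  also have "\<dots> = (\<Sum>e\<in>G. of_real ((cmod (ip e x))\<^sup>2))"
    using assms by (intro sum.cong refl) (simp add: ip_proj complex_norm_square mult_ac del: of_real_power)
  finally show ?thesis
    using assms by (simp add: vnorm_power2)
qed

text \<open>This is convergence in the form that \<open>has_sum\<close> uses, with one
  \<open>F\<close> that serves all larger \<open>G\<close>. An approximant in the span of
  \<open>F\<close> also lies in the span of \<open>G\<close>, and \<open>proj G x\<close> is at
  least as close to \<open>x\<close>.\<close>

lemma onb_approximation:
  assumes "orthonormal_basis V ip E" "x \<in> V" "\<epsilon> > 0"
  obtains F where "finite F" "F \<subseteq> E"
    "\<And>G. finite G \<Longrightarrow> F \<subseteq> G \<Longrightarrow> G \<subseteq> E \<Longrightarrow> vnorm (x - proj G x) < \<epsilon>"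
proof -
  have on: "orthonormal E" and dense: "dense_span V ip E"
    using assms(1) by (auto simp: orthonormal_basis_iff)
  obtain y where y: "y \<in> span E" "vnorm (x - y) < \<epsilon>"
    using dense[unfolded dense_span_def, THEN conjunct2, THEN bspec, OF assms(2)] assms(3) by meson
  then obtain F r where F: "finite F" "F \<subseteq> E" "y = (\<Sum>a\<in>F. r a *C a)"
    by (auto simp: span_explicit)
  have "vnorm (x - proj G x) < \<epsilon>" if "finite G" "F \<subseteq> G" "G \<subseteq> E" for G
  proof -
    have "y \<in> span G"
      unfolding F(3) using that(2) by (intro span_sum span_scale span_base) auto
    then show ?thesis
      using proj_best_approximation[of G x y] orthonormal_subset[OF on] that assms(2) y(2) by force
  qed
  then show ?thesis using F by (intro that[of F])
qed

text \<open>A bounded linear functional commutes with finite projections, which converge to the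
  identity. It covers both Parseval's identity and the expansion of
  \<open>ip e (C (\<rho> e))\<close> along the basis.\<close>

lemma has_sum_functional_onb:
  fixes \<phi> :: "'v \<Rightarrow> complex"
  assumes E: "orthonormal_basis V ip E" and x: "x \<in> V"
    and add: "\<And>u v. u \<in> V \<Longrightarrow> v \<in> V \<Longrightarrow> \<phi> (u + v) = \<phi> u + \<phi> v"
    and scale: "\<And>c u. u \<in> V \<Longrightarrow> \<phi> (c *C u) = c * \<phi> u"
    and bounded: "\<And>u. u \<in> V \<Longrightarrow> cmod (\<phi> u) \<le> K * vnorm u"
  shows "((\<lambda>f. \<phi> f * ip f x) has_sum \<phi> x) E"
  unfolding has_sum_def
proof (rule tendstoI)
  fix \<epsilon> :: real assume "\<epsilon> > 0"
  \<comment> \<open>The absolute value and the \<open>+ 1\<close> keep the divisor positive for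
    every real \<open>K\<close>.\<close>
  then have eps': "\<epsilon> / (\<bar>K\<bar> + 1) > 0" by simp
  have on: "orthonormal E" using E by (simp add: orthonormal_basis_iff)
  have zero: "\<phi> 0 = 0" using scale[of 0 0] by simp
  have diff: "\<phi> (u - v) = \<phi> u - \<phi> v" if "u \<in> V" "v \<in> V" for u v
    using add[of "u - v" v] that by simp
  have sum: "\<phi> (sum h G) = (\<Sum>g\<in>G. \<phi> (h g))" if "\<And>g. g \<in> G \<Longrightarrow> h g \<in> V" for h :: "'v \<Rightarrow> 'v" and G
    using that by (induction G rule: infinite_finite_induct) (auto simp: zero add)
  obtain F where F: "finite F" "F \<subseteq> E"
    "\<And>G. finite G \<Longrightarrow> F \<subseteq> G \<Longrightarrow> G \<subseteq> E \<Longrightarrow> vnorm (x - proj G x) < \<epsilon> / (\<bar>K\<bar> + 1)"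
    by (rule onb_approximation[OF E x eps']) (rule that)
  show "\<forall>\<^sub>F G in finite_subsets_at_top E. dist (\<Sum>f\<in>G. \<phi> f * ip f x) (\<phi> x) < \<epsilon>"
    unfolding eventually_finite_subsets_at_top
  proof (intro exI[of _ F] conjI allI impI F)
    fix G assume G: "finite G \<and> F \<subseteq> G \<and> G \<subseteq> E"
    have onG: "orthonormal G" and GV: "G \<subseteq> V"
      using orthonormal_subset[OF on] G by (auto simp: orthonormal_def)
    have "(\<Sum>f\<in>G. \<phi> f * ip f x) = \<phi> (proj G x)"
      unfolding proj_def using GV by (subst sum) (auto intro!: sum.cong simp: scale mult_ac)
    then have "dist (\<Sum>f\<in>G. \<phi> f * ip f x) (\<phi> x) = cmod (\<phi> (x - proj G x))"
      using x onG by (simp add: dist_norm norm_minus_commute diff)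
    also have "\<dots> \<le> K * vnorm (x - proj G x)"
      using x onG by (intro bounded) auto
    also have "\<dots> \<le> (\<bar>K\<bar> + 1) * vnorm (x - proj G x)"
      using x onG by (intro mult_right_mono) auto
    also have "\<dots> < \<epsilon>"
      using F(3)[of G] G by (simp add: field_simps)
    finally show "dist (\<Sum>f\<in>G. \<phi> f * ip f x) (\<phi> x) < \<epsilon>" .
  qed
qed

lemma parseval:
  assumes "orthonormal_basis V ip E" "x \<in> V" "y \<in> V"
  shows "((\<lambda>e. ip x e * ip e y) has_sum ip x y) E"
  by (rule has_sum_functional_onb[OF assms(1,3), where K = "vnorm x"])
    (use assms cauchy_schwarz in auto)


section \<open>Existence of orthonormal bases in Hilbert spaces\<close>

lemma proj_diff_power2:
  assumes "orthonormal H" "finite H" "G \<subseteq> H" "x \<in> V"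
  shows "(vnorm (proj H x - proj G x))\<^sup>2 = (\<Sum>e\<in>H. (cmod (ip e x))\<^sup>2) - (\<Sum>e\<in>G. (cmod (ip e x))\<^sup>2)"
proof -
  have "proj H x - proj G x = proj (H - G) x"
    unfolding proj_def using assms(2,3) by (simp add: sum_diff)
  then show ?thesis
    using vnorm_proj_power2[of "H - G" x] orthonormal_subset[OF assms(1), of "H - G"] assms(2-4)
    by (simp add: sum_diff)
qed

lemma bessel:
  assumes "orthonormal G" "finite G" "x \<in> V"
  shows "(\<Sum>e\<in>G. (cmod (ip e x))\<^sup>2) \<le> (vnorm x)\<^sup>2"
  using proj_pythagoras[OF assms] vnorm_proj_power2[OF assms] by simp

lemma maximal_orthonormal_exists:
  obtains E where "orthonormal E" "\<And>E'. orthonormal E' \<Longrightarrow> E \<subseteq> E' \<Longrightarrow> E' = E"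
proof -
  have "\<exists>M\<in>{E. orthonormal E}. \<forall>X\<in>{E. orthonormal E}. M \<subseteq> X \<longrightarrow> X = M"
  proof (rule subset_Zorn')
    fix C assume C: "subset.chain {E. orthonormal E} C"
    have on: "orthonormal X" if "X \<in> C" for X
      using C that by (auto simp: subset.chain_def)
    have "ip e f = (if e = f then 1 else 0)" if ef: "e \<in> \<Union>C" "f \<in> \<Union>C" for e f
    proof -
      obtain X Y where XY: "X \<in> C" "Y \<in> C" "e \<in> X" "f \<in> Y" using ef by blast
      then have "X \<subseteq> Y \<or> Y \<subseteq> X"
        using C by (auto simp: subset_chain_def)
      then obtain Z where "Z \<in> C" "e \<in> Z" "f \<in> Z" using XY by blast
      then show ?thesis using on[of Z] by (auto simp: orthonormal_def)
    qed
    moreover have "\<Union>C \<subseteq> V" using on by (auto simp: orthonormal_def)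
    ultimately show "\<Union>C \<in> {E. orthonormal E}" by (auto simp: orthonormal_def)
  qed
  then show ?thesis using that by blast
qed

text \<open>\<open>has_trace\<close> quantifies over all orthonormal bases, so it yields information
  only once some basis is known to exist. A maximal orthonormal set has dense span: otherwise some
  \<open>x\<close> stays away from the span, its finite projections converge to some
  \<open>L\<close> by completeness, and \<open>x - L\<close> normalises to a vector that could be
  added.\<close>

lemma orthonormal_basis_exists:
  assumes "hilbert_space V ip"
  shows "\<exists>E. orthonormal_basis V ip E"
proof -
  obtain E where E: "orthonormal E" and max: "\<And>E'. orthonormal E' \<Longrightarrow> E \<subseteq> E' \<Longrightarrow> E' = E"
    by (rule maximal_orthonormal_exists) (rule that)
  have EV: "E \<subseteq> V" using E by (simp add: orthonormal_def)
  have "\<exists>y\<in>span E. vnorm (x - y) < \<epsilon>" if x: "x \<in> V" and eps: "\<epsilon> > 0" for x \<epsilon>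
  proof (rule ccontr)
    assume contra: "\<not> (\<exists>y\<in>span E. vnorm (x - y) < \<epsilon>)"
    define a where "a G = (\<Sum>e\<in>G. (cmod (ip e x))\<^sup>2)" for G
    define \<G> where "\<G> = {G. finite G \<and> G \<subseteq> E}"
    have on: "orthonormal G" "finite G" "G \<subseteq> E" if "G \<in> \<G>" for G
      using that orthonormal_subset[OF E] by (auto simp: \<G>_def)
    have bdd: "bdd_above (a ` \<G>)"
      using bessel[OF on(1,2) x] by (auto simp: a_def intro!: bdd_aboveI2)
    define s where "s = Sup (a ` \<G>)"
    have le_s: "a G \<le> s" if "G \<in> \<G>" for G
      unfolding s_def using bdd that by (intro cSup_upper) auto
    have "\<exists>G\<in>\<G>. s - 1 / real (Suc n) < a G" for n
    proof -
      have "{} \<in> \<G>" by (simp add: \<G>_def)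
      then have "\<exists>y\<in>a ` \<G>. s - 1 / real (Suc n) < y"
        unfolding s_def using bdd by (subst less_cSup_iff[symmetric]) (auto simp del: of_nat_Suc)
      then show ?thesis by blast
    qed
    \<comment> \<open>\<open>E\<close> may be uncountable, so a sequence of finite subsets is picked
      whose Bessel sums approach the supremum. Enlarging \<open>G n\<close> then moves the
      projection by at most \<open>r n\<close>.\<close>
    then obtain G where G: "\<And>n. G n \<in> \<G>" "\<And>n. s - 1 / real (Suc n) < a (G n)" by metis
    define P where "P n = proj (G n) x" for n
    define r where "r n = sqrt (1 / real (Suc n))" for n
    have r0: "r \<longlonglongrightarrow> 0"
      unfolding r_def using tendsto_real_sqrt[OF LIMSEQ_inverse_real_of_nat] by (simp add: inverse_eq_divide)
    have PV: "P n \<in> V" for n using on G by (simp add: P_def)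
    have dist: "vnorm (proj H x - P n) \<le> r n" if "H \<in> \<G>" "G n \<subseteq> H" for H n
    proof -
      have "(vnorm (proj H x - P n))\<^sup>2 = a H - a (G n)"
        unfolding P_def a_def using on(1,2)[OF that(1)] that(2) x by (intro proj_diff_power2)
      also have "\<dots> \<le> 1 / real (Suc n)" using le_s[OF that(1)] G(2)[of n] by simp
      finally show ?thesis unfolding r_def by (rule real_le_rsqrt)
    qed
    have dist2: "vnorm (P m - P n) \<le> r m + r n" for m n
    proof -
      \<comment> \<open>The sets \<open>G n\<close> need not be nested, so two projections are
        compared through the one onto the union.\<close>
      define H where "H = G m \<union> G n"
      have H: "H \<in> \<G>" using G(1)[of m] G(1)[of n] by (auto simp: H_def \<G>_def)
      have HV: "proj H x \<in> V" using on[OF H] by simp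
      have "vnorm (P m - P n) = vnorm ((P m - proj H x) + (proj H x - P n))" by simp
      also have "\<dots> \<le> vnorm (P m - proj H x) + vnorm (proj H x - P n)"
        using PV HV by (intro vnorm_triangle) auto
      also have "vnorm (P m - proj H x) = vnorm (proj H x - P m)"
        using PV HV by (intro vnorm_minus_commute) auto
      also have "\<dots> + vnorm (proj H x - P n) \<le> r m + r n"
        using H by (intro add_mono dist) (auto simp: H_def)
      finally show ?thesis .
    qed
    have "\<exists>N. \<forall>m\<ge>N. \<forall>n\<ge>N. vnorm (P m - P n) < e" if "e > 0" for e
    proof -
      have "eventually (\<lambda>n. r n < e / 2) sequentially"
        using r0 that by (intro order_tendstoD(2)) auto
      then obtain N where N: "\<And>n. n \<ge> N \<Longrightarrow> r n < e / 2" by (auto simp: eventually_sequentially)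
      have "vnorm (P m - P n) < e" if "m \<ge> N" "n \<ge> N" for m n
        using dist2[of m n] N[OF that(1)] N[OF that(2)] by simp
      then show ?thesis by blast
    qed
    then obtain L where L: "L \<in> V" "(\<lambda>n. vnorm (P n - L)) \<longlonglongrightarrow> 0"
      using assms[unfolded hilbert_space_def, THEN conjunct2, THEN conjunct2, THEN spec, of P] PV
      by (elim impE bexE) (blast, rule that)
    define w where "w = x - L"
    have wV: "w \<in> V" using x L by (simp add: w_def)
    have orth: "ip e w = 0" if e: "e \<in> E" for e
    proof -
      have eV: "e \<in> V" and e1: "vnorm e = 1"
        using e E by (auto simp: orthonormal_def hnorm_def)
      have bound: "cmod (ip e w) \<le> r n + vnorm (P n - L)" for n
      proof -
        \<comment> \<open>Once \<open>e\<close> belongs to the projection set, \<open>ip e\<close>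
          no longer distinguishes \<open>x\<close> from its projection, and adding \<open>e\<close>
          costs at most \<open>r n\<close>.\<close>
        define H where "H = insert e (G n)"
        have H: "H \<in> \<G>" using G(1)[of n] e by (auto simp: H_def \<G>_def)
        have HV: "proj H x \<in> V" using on[OF H] by simp
        have "ip e w = ip e (proj H x - P n) + ip e (P n - L)"
          using ip_proj[OF on(1,2)[OF H] x, of e] HV PV L(1) eV x by (simp add: w_def H_def)
        also have "cmod \<dots> \<le> cmod (ip e (proj H x - P n)) + cmod (ip e (P n - L))"
          by (rule norm_triangle_ineq)
        also have "\<dots> \<le> vnorm (proj H x - P n) + vnorm (P n - L)"
          using cauchy_schwarz[OF eV, of "proj H x - P n"] cauchy_schwarz[OF eV, of "P n - L"] HV PV L(1)
          by (simp add: e1)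
        also have "vnorm (proj H x - P n) \<le> r n"
          using H by (intro dist) (auto simp: H_def)
        finally show ?thesis by simp
      qed
      have "(\<lambda>n. r n + vnorm (P n - L)) \<longlonglongrightarrow> 0"
        using tendsto_add[OF r0 L(2)] by simp
      then have "cmod (ip e w) \<le> 0"
        by (rule LIMSEQ_le_const) (use bound in blast)
      then show ?thesis by simp
    qed
    have "w \<noteq> 0"
    proof
      assume "w = 0"
      then have "L = x" by (simp add: w_def)
      then have "eventually (\<lambda>n. vnorm (P n - x) < \<epsilon>) sequentially"
        using L(2) eps by (intro order_tendstoD(2)) auto
      then obtain n where "vnorm (P n - x) < \<epsilon>" by (auto simp: eventually_sequentially)
      moreover have "P n \<in> span E"
        using proj_in_span[of "G n" x] span_mono[OF on(3)[OF G(1), of n]] by (auto simp: P_def)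
      ultimately show False
        using contra vnorm_minus_commute[OF PV x, of n] by auto
    qed
    define c where "c = vnorm w"
    have c: "c > 0"
      using vnorm_eq_zero[OF wV] \<open>w \<noteq> 0\<close> vnorm_nonneg[OF wV] unfolding c_def by linarith
    define u where "u = of_real (1 / c) *C w"
    have uV: "u \<in> V" using wV by (simp add: u_def)
    have uu: "ip u u = 1"
      using wV c by (simp add: u_def ip_self[OF wV] power2_eq_square flip: c_def)
    have ue: "ip e u = 0 \<and> ip u e = 0" if "e \<in> E" for e
      using orth[OF that] that EV wV ip_commute[of e w] by (auto simp: u_def)
    have "orthonormal (insert u E)"
      unfolding orthonormal_def using E uV uu ue by (auto simp: orthonormal_def)
    then have "u \<in> E" using max by blast
    then show False using ue uu by simp
  qed
  then have "dense_span V ip E" using EV by (simp add: dense_span_def)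
  then show ?thesis using E orthonormal_basis_iff by blast
qed

end

section \<open>Traces of products of positive operators\<close>

lemma has_sum_sum_finite:
  fixes f :: "'i \<Rightarrow> 'a \<Rightarrow> 'b::topological_comm_monoid_add"
  assumes "\<And>i. i \<in> I \<Longrightarrow> (f i has_sum s i) A"
  shows "((\<lambda>x. \<Sum>i\<in>I. f i x) has_sum (\<Sum>i\<in>I. s i)) A"
  using assms by (induction I rule: infinite_finite_induct) (auto intro: has_sum_add)

context inner_product_space begin

lemma bounded_operatorD:
  assumes "bounded_operator V ip T"
  shows "x \<in> V \<Longrightarrow> T x \<in> V"
    and "x \<in> V \<Longrightarrow> y \<in> V \<Longrightarrow> T (x + y) = T x + T y"
    and "x \<in> V \<Longrightarrow> T (c *C x) = c *C T x"
  using assms unfolding bounded_operator_def by blast+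

lemma bounded_operator_bound:
  assumes "bounded_operator V ip T"
  obtains K where "K \<ge> 0" "\<And>x. x \<in> V \<Longrightarrow> vnorm (T x) \<le> K * vnorm x"
proof -
  obtain K where K: "\<And>x. x \<in> V \<Longrightarrow> vnorm (T x) \<le> K * vnorm x"
    using assms unfolding bounded_operator_def by blast
  have "vnorm (T x) \<le> \<bar>K\<bar> * vnorm x" if "x \<in> V" for x
    using K[OF that] mult_right_mono[of K "\<bar>K\<bar>" "vnorm x"] vnorm_nonneg[OF that] by linarith
  then show ?thesis by (intro that[of "\<bar>K\<bar>"]) auto
qed

lemma positive_operatorD:
  assumes "positive_operator V ip T"
  shows "bounded_operator V ip T" and "x \<in> V \<Longrightarrow> ip x (T x) \<in> \<real>\<^sub>\<ge>\<^sub>0"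
  using assms by (auto simp: positive_operator_def complex_nonneg_Reals_iff complex_is_Real_iff)

lemma bounded_operator_sum:
  assumes T: "bounded_operator V ip T" and h: "\<And>g. g \<in> G \<Longrightarrow> h g \<in> V"
  shows "T (sum h G) = (\<Sum>g\<in>G. T (h g))"
proof -
  have "T 0 = 0" using bounded_operatorD(3)[OF T, of 0 0] by simp
  then show ?thesis
    using h by (induction G rule: infinite_finite_induct) (auto simp: bounded_operatorD(2)[OF T])
qed

lemma bounded_operator_matrix_form:
  assumes T: "bounded_operator V ip T" and x: "\<And>i. i \<in> I \<Longrightarrow> x i \<in> V"
  shows "ip (\<Sum>i\<in>I. c i *C x i) (T (\<Sum>i\<in>I. c i *C x i)) =
    (\<Sum>i\<in>I. \<Sum>j\<in>I. cnj (c i) * c j * ip (x i) (T (x j)))"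
proof -
  define z where "z = (\<Sum>i\<in>I. c i *C x i)"
  have TV: "T (x j) \<in> V" if "j \<in> I" for j
    using bounded_operatorD(1)[OF T x[OF that]] .
  have Tz: "T z = (\<Sum>j\<in>I. c j *C T (x j))"
    unfolding z_def using x by (simp add: bounded_operator_sum[OF T] bounded_operatorD(3)[OF T])
  have "ip z (T z) = (\<Sum>i\<in>I. cnj (c i) * ip (x i) (T z))"
    unfolding z_def by (subst ip_sum_left) (use x bounded_operatorD(1)[OF T] in auto)
  also have "\<dots> = (\<Sum>i\<in>I. cnj (c i) * (\<Sum>j\<in>I. c j * ip (x i) (T (x j))))"
    unfolding Tz using x TV by (intro sum.cong refl) (simp add: ip_sum_right)
  finally show ?thesis unfolding z_def by (simp add: sum_distrib_left mult_ac)
qed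

lemma positive_operator_psd:
  assumes "positive_operator V ip T" "\<And>i. i \<in> I \<Longrightarrow> x i \<in> V"
  shows "psd_matrix_on I (\<lambda>i j. ip (x i) (T (x j)))"
  unfolding psd_matrix_on_def
proof
  fix c
  show "(\<Sum>i\<in>I. \<Sum>j\<in>I. cnj (c i) * c j * ip (x i) (T (x j))) \<in> \<real>\<^sub>\<ge>\<^sub>0"
    using positive_operatorD[OF assms(1)] assms(2)
    by (subst bounded_operator_matrix_form[symmetric]) auto
qed

text \<open>Pairing this operator with a second positive operator by Schur's theorem bounds the
  pairing of \<open>T\<close> from above by \<open>K\<close> times a trace.\<close>

lemma positive_operator_bound_minus:
  assumes T: "positive_operator V ip T" and K: "\<And>x. x \<in> V \<Longrightarrow> vnorm (T x) \<le> K * vnorm x" "K \<ge> 0"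
  shows "positive_operator V ip (\<lambda>x. of_real K *C x - T x)"
proof -
  note TB = positive_operatorD(1)[OF T]
  have TV: "T x \<in> V" if "x \<in> V" for x using bounded_operatorD(1)[OF TB that] .
  have bnd: "vnorm (of_real K *C x - T x) \<le> (2 * K) * vnorm x" if "x \<in> V" for x
  proof -
    have "vnorm (of_real K *C x + (-1) *C T x) \<le> vnorm (of_real K *C x) + vnorm ((-1) *C T x)"
      using that TV by (intro vnorm_triangle) auto
    also have "\<dots> \<le> K * vnorm x + K * vnorm x"
      using K(1)[OF that] K(2) vnorm_scale[OF that, of "of_real K"] vnorm_scale[OF TV[OF that], of "-1"]
      by simp
    finally show ?thesis by simp
  qed
  have pos: "ip x (of_real K *C x - T x) \<in> \<real>\<^sub>\<ge>\<^sub>0" if x: "x \<in> V" for x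
  proof -
    have "Re (ip x (T x)) \<le> vnorm x * vnorm (T x)"
      using cauchy_schwarz[OF x TV[OF x]] complex_Re_le_cmod[of "ip x (T x)"] by linarith
    also have "\<dots> \<le> vnorm x * (K * vnorm x)"
      using K x by (intro mult_left_mono) auto
    finally have "Re (ip x (T x)) \<le> K * (vnorm x)\<^sup>2"
      by (simp add: power2_eq_square mult_ac)
    then show ?thesis
      using positive_operatorD(2)[OF T x] x TV
      by (simp add: complex_nonneg_Reals_iff ip_self[OF x] del: of_real_power)
  qed
  have "bounded_operator V ip (\<lambda>x. of_real K *C x - T x)"
    unfolding bounded_operator_def
    using TV bnd by (auto simp: bounded_operatorD[OF TB] algebra_simps scale_right_diff_distrib
      scale_right_distrib intro!: exI[of _ "2 * K"])
  then show ?thesis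
    using pos by (auto simp: positive_operator_def complex_nonneg_Reals_iff complex_is_Real_iff)
qed

text \<open>The index set \<open>F\<close> times \<open>G\<close> is not a square, so Schur's
  theorem does not apply to it directly. The square sum with weight 1 on \<open>F\<close> and 1/2 on
  \<open>W\<close> contains the two mixed blocks with factor 1/2 each; they are conjugate, so
  together they give one full mixed block. What remains is the block over \<open>W\<close> with
  factor 1/4, bounded by \<open>K\<close> times the trace of \<open>\<rho>\<close> over
  \<open>W\<close>.\<close>

lemma trace_partial_sum_lower_bound:
  assumes C: "positive_operator V ip C" and \<rho>: "positive_operator V ip \<rho>"
    and K: "\<And>x. x \<in> V \<Longrightarrow> vnorm (C x) \<le> K * vnorm x" "K \<ge> 0"
    and G: "orthonormal G" "finite G" and FG: "F \<subseteq> G"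
  shows "Re (\<Sum>e\<in>F. \<Sum>f\<in>G. ip e (C f) * ip f (\<rho> e)) \<ge> - (K / 4) * (\<Sum>e\<in>G - F. Re (ip e (\<rho> e)))"
proof -
  define W where "W = G - F"
  define S where "S X Y = (\<Sum>e\<in>X. \<Sum>f\<in>Y. ip e (C f) * ip f (\<rho> e))" for X Y
  have fin: "finite F" "finite W" using G FG finite_subset by (auto simp: W_def)
  have GV: "e \<in> V" if "e \<in> G" for e using G that by (auto simp: orthonormal_def)
  have psdC: "psd_matrix_on G (\<lambda>e f. ip e (C f))"
    using positive_operator_psd[OF C, of G "\<lambda>e. e"] GV by simp
  have psd\<rho>: "psd_matrix_on X (\<lambda>e f. ip f (\<rho> e))" if "X \<subseteq> G" for X
    using psd_matrix_on_transpose[OF positive_operator_psd[OF \<rho>, of X "\<lambda>e. e"]] GV that by auto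
  \<comment> \<open>With weights 1 on \<open>F\<close> and 1/2 on \<open>W\<close>, Schur's theorem gives \<open>Re (S F F + S F W) \<ge> - Re (S W W) / 4\<close>.\<close>
  define a :: "'v \<Rightarrow> complex" where "a e = (if e \<in> F then 1 else 1 / 2)" for e
  have split: "(\<Sum>e\<in>G. h e) = (\<Sum>e\<in>F. h e) + (\<Sum>e\<in>W. h e)" for h :: "'v \<Rightarrow> complex"
    using sum.subset_diff[OF FG G(2), of h] by (simp add: W_def add.commute)
  have aF: "a e = 1" if "e \<in> F" for e using that by (simp add: a_def)
  have aW: "a e = 1 / 2" if "e \<in> W" for e using that by (auto simp: a_def W_def)
  have "(\<Sum>e\<in>G. \<Sum>f\<in>G. (cnj (a e) * a f * ip e (C f)) * ip f (\<rho> e)) \<in> \<real>\<^sub>\<ge>\<^sub>0"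
    by (rule schur_product_sum[OF G(2) psd_matrix_on_congruence[OF psdC] psd\<rho>[OF subset_refl]])
  also have "(\<Sum>e\<in>G. \<Sum>f\<in>G. (cnj (a e) * a f * ip e (C f)) * ip f (\<rho> e)) =
      S F F + S F W / 2 + S W F / 2 + S W W / 4"
    unfolding S_def split
    by (simp add: aF aW sum.distrib sum_divide_distrib)
  finally have 1: "0 \<le> Re (S F F) + Re (S F W) / 2 + Re (S W F) / 2 + Re (S W W) / 4"
    by (simp add: complex_nonneg_Reals_iff)
  have "cnj (S W F) = S F W"
  proof -
    have "cnj (ip f (C e) * ip e (\<rho> f)) = ip e (C f) * ip f (\<rho> e)" if "e \<in> G" "f \<in> G" for e f
      using psd_matrix_on_hermitian[OF psdC that(2,1) G(2)]
        psd_matrix_on_hermitian[OF psd\<rho>[OF subset_refl] that(2,1) G(2)] by simp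
    then have "(\<Sum>e\<in>F. \<Sum>f\<in>W. cnj (ip f (C e) * ip e (\<rho> f))) = S F W"
      unfolding S_def using FG by (intro sum.cong refl) (auto simp: W_def)
    then show ?thesis unfolding S_def by (subst sum.swap) (simp only: cnj_sum)
  qed
  then have 2: "Re (S W F) = Re (S F W)"
    by (metis cnj.sel(1))
  \<comment> \<open>Schur's theorem for K - C in place of C turns the block over \<open>W\<close>
    into an upper estimate.\<close>
  have "(\<Sum>e\<in>W. \<Sum>f\<in>W. ip e (of_real K *C f - C f) * ip f (\<rho> e)) \<in> \<real>\<^sub>\<ge>\<^sub>0"
  proof (rule schur_product_sum[OF fin(2) _ psd\<rho>])
    show "psd_matrix_on W (\<lambda>e f. ip e (of_real K *C f - C f))"
      using positive_operator_psd[OF positive_operator_bound_minus[OF C K], of W "\<lambda>e. e"] GV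
      by (auto simp: W_def)
  qed (auto simp: W_def)
  also have "(\<Sum>e\<in>W. \<Sum>f\<in>W. ip e (of_real K *C f - C f) * ip f (\<rho> e)) =
     of_real K * (\<Sum>e\<in>W. ip e (\<rho> e)) - S W W"
  proof -
    have "ip e (of_real K *C f - C f) = of_real K * (if f = e then 1 else 0) - ip e (C f)"
      if "e \<in> W" "f \<in> W" for e f
      using G(1) GV bounded_operatorD(1)[OF positive_operatorD(1)[OF C]] that
      by (auto simp: W_def orthonormal_def)
    then have "(\<Sum>e\<in>W. \<Sum>f\<in>W. ip e (of_real K *C f - C f) * ip f (\<rho> e)) =
        (\<Sum>e\<in>W. \<Sum>f\<in>W. (of_real K * (if f = e then 1 else 0) - ip e (C f)) * ip f (\<rho> e))"
      by simp
    also have "\<dots> = (\<Sum>e\<in>W. \<Sum>f\<in>W. if f = e then of_real K * ip f (\<rho> e) else 0) - S W W"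
      unfolding S_def sum_subtractf[symmetric] by (intro sum.cong refl) (auto simp: algebra_simps)
    also have "(\<Sum>e\<in>W. \<Sum>f\<in>W. if f = e then of_real K * ip f (\<rho> e) else 0) = of_real K * (\<Sum>e\<in>W. ip e (\<rho> e))"
      using fin by (simp add: sum_distrib_left)
    finally show ?thesis .
  qed
  finally have 3: "Re (S W W) \<le> K * (\<Sum>e\<in>W. Re (ip e (\<rho> e)))"
    by (simp add: complex_nonneg_Reals_iff)
  have "Re (\<Sum>e\<in>F. \<Sum>f\<in>G. ip e (C f) * ip f (\<rho> e)) = Re (S F F) + Re (S F W)"
    unfolding S_def split by (simp add: sum.distrib)
  then show ?thesis using 1 2 3 by (simp add: W_def)
qed

text \<open>Two limits are taken in order. For fixed \<open>F\<close> the inner index set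
  \<open>G\<close> grows to \<open>E\<close>, which recovers \<open>ip e (C (\<rho> e))\<close> for
  each \<open>e\<close> in \<open>F\<close>; then \<open>F\<close> grows to \<open>E\<close>, and
  the error \<open>(K / 4) * (Re r - R F)\<close> disappears because the trace of
  \<open>\<rho>\<close> converges.\<close>

lemma trace_product_nonneg:
  assumes C: "positive_operator V ip C" and \<rho>: "positive_operator V ip \<rho>"
    and E: "orthonormal_basis V ip E"
    and r: "((\<lambda>e. ip e (\<rho> e)) has_sum r) E"
    and t: "((\<lambda>e. ip e (C (\<rho> e))) has_sum t) E"
  shows "Re t \<ge> 0"
proof -
  note CB = positive_operatorD(1)[OF C] and \<rho>B = positive_operatorD(1)[OF \<rho>]
  obtain K where K: "K \<ge> 0" "\<And>x. x \<in> V \<Longrightarrow> vnorm (C x) \<le> K * vnorm x"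
    by (rule bounded_operator_bound[OF CB]) (rule that)
  have on: "orthonormal E" using E by (simp add: orthonormal_basis_iff)
  have EV: "e \<in> V" if "e \<in> E" for e using on that by (auto simp: orthonormal_def)
  define R where "R X = (\<Sum>e\<in>X. Re (ip e (\<rho> e)))" for X
  have R_lim: "(R \<longlongrightarrow> Re r) (finite_subsets_at_top E)"
    using tendsto_Re[OF r[unfolded has_sum_def]] by (simp add: R_def[abs_def])
  have R_nonneg: "R X \<ge> 0" if "X \<subseteq> E" for X
    unfolding R_def using positive_operatorD(2)[OF \<rho>] EV that
    by (intro sum_nonneg) (auto simp: complex_nonneg_Reals_iff)
  have R_le: "R X \<le> Re r" if X: "finite X" "X \<subseteq> E" for X
  proof (rule tendsto_lowerbound[OF R_lim])
    have "R X \<le> R Y" if "finite Y" "X \<subseteq> Y" "Y \<subseteq> E" for Y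
      using R_nonneg[of "Y - X"] sum.subset_diff[OF that(2,1), of "\<lambda>e. Re (ip e (\<rho> e))"] that
      by (auto simp: R_def)
    then show "\<forall>\<^sub>F Y in finite_subsets_at_top E. R X \<le> R Y"
      unfolding eventually_finite_subsets_at_top using X by (intro exI[of _ X]) auto
  qed simp
  have key: "Re (\<Sum>e\<in>F. ip e (C (\<rho> e))) \<ge> - (K / 4) * (Re r - R F)" if F: "finite F" "F \<subseteq> E" for F
  proof -
    have "((\<lambda>f. ip e (C f) * ip f (\<rho> e)) has_sum ip e (C (\<rho> e))) E" if e: "e \<in> F" for e
    proof (rule has_sum_functional_onb[OF E, where K = "K * vnorm e"])
      have eV: "e \<in> V" using e F EV by auto
      show "\<rho> e \<in> V" using bounded_operatorD(1)[OF \<rho>B eV] .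
      show "ip e (C (u + v)) = ip e (C u) + ip e (C v)" if "u \<in> V" "v \<in> V" for u v
        using that eV bounded_operatorD[OF CB] by simp
      show "ip e (C (c *C u)) = c * ip e (C u)" if "u \<in> V" for c u
        using that eV bounded_operatorD[OF CB] by simp
      show "cmod (ip e (C u)) \<le> K * vnorm e * vnorm u" if "u \<in> V" for u
      proof -
        have "cmod (ip e (C u)) \<le> vnorm e * vnorm (C u)"
          using that eV bounded_operatorD(1)[OF CB] by (intro cauchy_schwarz)
        also have "\<dots> \<le> vnorm e * (K * vnorm u)"
          using K(2) that eV by (intro mult_left_mono) auto
        finally show ?thesis by (simp add: mult_ac)
      qed
    qed
    then have "((\<lambda>f. \<Sum>e\<in>F. ip e (C f) * ip f (\<rho> e)) has_sum (\<Sum>e\<in>F. ip e (C (\<rho> e)))) E"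
      by (rule has_sum_sum_finite)
    then have lim: "((\<lambda>G. Re (\<Sum>f\<in>G. \<Sum>e\<in>F. ip e (C f) * ip f (\<rho> e))) \<longlongrightarrow>
        Re (\<Sum>e\<in>F. ip e (C (\<rho> e)))) (finite_subsets_at_top E)"
      unfolding has_sum_def by (rule tendsto_Re)
    show ?thesis
    proof (rule tendsto_lowerbound[OF lim])
      have "- (K / 4) * (Re r - R F) \<le> Re (\<Sum>f\<in>G. \<Sum>e\<in>F. ip e (C f) * ip f (\<rho> e))"
        if G: "finite G" "F \<subseteq> G" "G \<subseteq> E" for G
      proof -
        \<comment> \<open>Replacing \<open>R G\<close> by the full trace makes the error independent
          of \<open>G\<close>, so it survives the inner limit.\<close>
        have "R (G - F) = R G - R F"
          unfolding R_def using G F by (simp add: sum_diff)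
        then have "R (G - F) \<le> Re r - R F"
          using R_le[of G] G by simp
        then have "- (K / 4) * (Re r - R F) \<le> - (K / 4) * R (G - F)"
          using K(1) by (intro mult_left_mono_neg) auto
        also have "\<dots> \<le> Re (\<Sum>e\<in>F. \<Sum>f\<in>G. ip e (C f) * ip f (\<rho> e))"
          unfolding R_def
          using G by (intro trace_partial_sum_lower_bound C \<rho> K orthonormal_subset[OF on]) auto
        finally show ?thesis by (subst sum.swap)
      qed
      then show "\<forall>\<^sub>F G in finite_subsets_at_top E.
          - (K / 4) * (Re r - R F) \<le> Re (\<Sum>f\<in>G. \<Sum>e\<in>F. ip e (C f) * ip f (\<rho> e))"
        unfolding eventually_finite_subsets_at_top using F by (intro exI[of _ F]) auto
    qed simp
  qed
  have "- (K / 4) * (Re r - Re r) \<le> Re t"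
  proof (rule tendsto_le)
    show "((\<lambda>F. Re (\<Sum>e\<in>F. ip e (C (\<rho> e)))) \<longlongrightarrow> Re t) (finite_subsets_at_top E)"
      using t unfolding has_sum_def by (rule tendsto_Re)
    show "((\<lambda>F. - (K / 4) * (Re r - R F)) \<longlongrightarrow> - (K / 4) * (Re r - Re r)) (finite_subsets_at_top E)"
      by (intro tendsto_intros R_lim)
    show "\<forall>\<^sub>F F in finite_subsets_at_top E. - (K / 4) * (Re r - R F) \<le> Re (\<Sum>e\<in>F. ip e (C (\<rho> e)))"
      unfolding eventually_finite_subsets_at_top using key by (intro exI[of _ "{}"]) auto
  qed simp
  then show ?thesis by simp
qed

end

section \<open>Tensor products of positive operators\<close>

context complex_vector_space begin

lemma hilbert_space_inner_product_space:
  "hilbert_space V ip \<Longrightarrow> inner_product_space scale V ip"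
  by unfold_locales (auto simp: hilbert_space_def)

end

context inner_product_space begin

text \<open>The quadratic form of a bounded operator is continuous and the nonnegative reals are
  closed. For a tensor product only finite sums of elementary tensors can be tested
  directly.\<close>

lemma positive_operator_dense:
  assumes T: "bounded_operator V ip T" and S: "dense_span V ip S"
    and pos: "\<And>z. z \<in> span S \<Longrightarrow> ip z (T z) \<in> \<real>\<^sub>\<ge>\<^sub>0"
  shows "positive_operator V ip T"
proof -
  obtain K where K: "K \<ge> 0" "\<And>x. x \<in> V \<Longrightarrow> vnorm (T x) \<le> K * vnorm x"
    by (rule bounded_operator_bound[OF T]) (rule that)
  have TV: "T x \<in> V" if "x \<in> V" for x using bounded_operatorD(1)[OF T that] .
  have Tdiff: "T (x - y) = T x - T y" if "x \<in> V" "y \<in> V" for x y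
    using bounded_operatorD(2)[OF T, of "x - y" y] that by simp
  have "ip x (T x) \<in> \<real>\<^sub>\<ge>\<^sub>0" if x: "x \<in> V" for x
  proof -
    have "\<exists>z\<in>span S. vnorm (x - z) < 1 / real (Suc n)" for n
      using S x unfolding dense_span_def by (metis of_nat_0_less_iff zero_less_Suc zero_less_divide_1_iff)
    then obtain z where z: "\<And>n. z n \<in> span S" "\<And>n. vnorm (x - z n) < 1 / real (Suc n)" by metis
    have zV: "z n \<in> V" for n
      using z(1)[of n] S span_in[of S] by (auto simp: dense_span_def)
    define \<delta> where "\<delta> n = vnorm (x - z n)" for n
    have \<delta>0: "\<delta> \<longlonglongrightarrow> 0"
    proof (rule tendsto_sandwich[OF _ _ tendsto_const LIMSEQ_inverse_real_of_nat])
      show "\<forall>\<^sub>F n in sequentially. 0 \<le> \<delta> n" using x zV by (simp add: \<delta>_def)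
      show "\<forall>\<^sub>F n in sequentially. \<delta> n \<le> inverse (real (Suc n))"
        using z(2) by (auto simp: \<delta>_def inverse_eq_divide less_imp_le)
    qed
    have bound: "cmod (ip (z n) (T (z n)) - ip x (T x)) \<le> \<delta> n * (K * vnorm x) + (vnorm x + \<delta> n) * (K * \<delta> n)" for n
    proof -
      have zn: "vnorm (z n) \<le> vnorm x + \<delta> n"
        using vnorm_triangle[of x "z n - x"] vnorm_minus_commute[of x "z n"] x zV by (simp add: \<delta>_def)
      have "cmod (ip (z n) (T (z n)) - ip x (T x)) = cmod (ip (x - z n) (T x) + ip (z n) (T (x - z n)))"
        using x zV TV by (simp add: Tdiff norm_minus_commute)
      also have "\<dots> \<le> cmod (ip (x - z n) (T x)) + cmod (ip (z n) (T (x - z n)))"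
        by (rule norm_triangle_ineq)
      also have "cmod (ip (x - z n) (T x)) \<le> \<delta> n * vnorm (T x)"
        unfolding \<delta>_def using x zV TV by (intro cauchy_schwarz) auto
      also have "\<delta> n * vnorm (T x) \<le> \<delta> n * (K * vnorm x)"
        using K(2)[OF x] x zV by (intro mult_left_mono) (auto simp: \<delta>_def)
      also have "cmod (ip (z n) (T (x - z n))) \<le> vnorm (z n) * vnorm (T (x - z n))"
        using x zV TV by (intro cauchy_schwarz) auto
      also have "vnorm (z n) * vnorm (T (x - z n)) \<le> (vnorm x + \<delta> n) * (K * \<delta> n)"
        using zn K(2)[of "x - z n"] x zV TV
        by (intro mult_mono) (auto simp: \<delta>_def)
      finally show ?thesis by simp
    qed
    have "(\<lambda>n. \<delta> n * (K * vnorm x) + (vnorm x + \<delta> n) * (K * \<delta> n)) \<longlonglongrightarrow>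
        0 * (K * vnorm x) + (vnorm x + 0) * (K * 0)"
      by (intro tendsto_intros \<delta>0)
    then have "(\<lambda>n. \<delta> n * (K * vnorm x) + (vnorm x + \<delta> n) * (K * \<delta> n)) \<longlonglongrightarrow> 0"
      by simp
    then have "(\<lambda>n. ip (z n) (T (z n)) - ip x (T x)) \<longlonglongrightarrow> 0"
      by (rule Lim_null_comparison[OF always_eventually, rotated]) (rule allI, rule bound)
    then have "(\<lambda>n. ip (z n) (T (z n))) \<longlonglongrightarrow> ip x (T x)"
      by (simp add: LIM_zero_iff)
    then show ?thesis
      using closed_sequentially[OF closed_nonneg_Reals_complex, of "\<lambda>n. ip (z n) (T (z n))"] pos z(1) by blast
  qed
  then show ?thesis
    using T by (auto simp: positive_operator_def complex_nonneg_Reals_iff complex_is_Real_iff)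
qed

end

context complex_vector_space begin

text \<open>On a finite sum of elementary tensors the quadratic form of the tensor operator is the
  sum of all entries of an entrywise product, namely of the matrices of \<open>S\<close> and of
  \<open>T\<close> on the tensor factors; this is where Schur's theorem enters.\<close>

lemma tensor_operator_positive:
  assumes HA: "hilbert_space VA ipA" and HB: "hilbert_space VB ipB"
    and tp: "tensor_product VA ipA VB ipB V ip \<tau>"
    and S: "positive_operator VA ipA S" and T: "positive_operator VB ipB T"
    and C: "tensor_operator VA VB V ip \<tau> S T C"
  shows "positive_operator V ip C"
proof -
  have H: "hilbert_space V ip" using tp by (simp add: tensor_product_def)
  interpret A: inner_product_space scale VA ipA by (rule hilbert_space_inner_product_space[OF HA])
  interpret B: inner_product_space scale VB ipB by (rule hilbert_space_inner_product_space[OF HB])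
  interpret inner_product_space scale V ip by (rule hilbert_space_inner_product_space[OF H])
  define E where "E = {\<tau> x y | x y. x \<in> VA \<and> y \<in> VB}"
  have E: "dense_span V ip E" using tp by (simp add: tensor_product_def E_def)
  have \<tau>_scale: "c *C \<tau> x y = \<tau> (c *C x) y" if "x \<in> VA" "y \<in> VB" for c x y
    using tp that by (simp add: tensor_product_def)
  have \<tau>_ip: "ip (\<tau> x y) (\<tau> x' y') = ipA x x' * ipB y y'"
    if "x \<in> VA" "x' \<in> VA" "y \<in> VB" "y' \<in> VB" for x x' y y'
    using tp that by (simp add: tensor_product_def)
  have \<tau>V: "\<tau> x y \<in> V" if "x \<in> VA" "y \<in> VB" for x y
    using E that by (auto simp: dense_span_def E_def)
  have CB: "bounded_operator V ip C"
    and C\<tau>: "\<And>x y. x \<in> VA \<Longrightarrow> y \<in> VB \<Longrightarrow> C (\<tau> x y) = \<tau> (S x) (T y)"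
    using C by (auto simp: tensor_operator_def)
  show ?thesis
  proof (rule positive_operator_dense[OF CB E])
    fix z assume "z \<in> span E"
    then obtain I r where I: "finite I" "I \<subseteq> E" "z = (\<Sum>a\<in>I. r a *C a)"
      by (auto simp: span_explicit)
    \<comment> \<open>The scalars are absorbed into the first factor, so that all weights become
      1.\<close>
    have "\<forall>a\<in>I. \<exists>x y. x \<in> VA \<and> y \<in> VB \<and> r a *C a = \<tau> x y"
    proof
      fix a assume "a \<in> I"
      then obtain x y where xy: "x \<in> VA" "y \<in> VB" "a = \<tau> x y" using I(2) by (auto simp: E_def)
      then show "\<exists>x y. x \<in> VA \<and> y \<in> VB \<and> r a *C a = \<tau> x y"
        using \<tau>_scale[of x y "r a"] by (intro exI[of _ "r a *C x"] exI[of _ y]) auto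
    qed
    then obtain X Y where XY: "\<And>a. a \<in> I \<Longrightarrow> X a \<in> VA" "\<And>a. a \<in> I \<Longrightarrow> Y a \<in> VB"
        "\<And>a. a \<in> I \<Longrightarrow> r a *C a = \<tau> (X a) (Y a)" by metis
    have z: "z = (\<Sum>a\<in>I. 1 *C \<tau> (X a) (Y a))" unfolding I(3) using XY(3) by simp
    have SX: "S (X a) \<in> VA" if "a \<in> I" for a
      using A.bounded_operatorD(1)[OF A.positive_operatorD(1)[OF S] XY(1)[OF that]] .
    have TY: "T (Y a) \<in> VB" if "a \<in> I" for a
      using B.bounded_operatorD(1)[OF B.positive_operatorD(1)[OF T] XY(2)[OF that]] .
    have "ip z (C z) = (\<Sum>a\<in>I. \<Sum>b\<in>I. cnj 1 * 1 * ip (\<tau> (X a) (Y a)) (C (\<tau> (X b) (Y b))))"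
      unfolding z using \<tau>V XY by (intro bounded_operator_matrix_form[OF CB]) auto
    also have "\<dots> = (\<Sum>a\<in>I. \<Sum>b\<in>I. ipA (X a) (S (X b)) * ipB (Y a) (T (Y b)))"
      using XY(1,2) SX TY by (intro sum.cong refl) (simp add: C\<tau> \<tau>_ip)
    finally show "ip z (C z) \<in> \<real>\<^sub>\<ge>\<^sub>0"
      using schur_product_sum[OF I(1) A.positive_operator_psd[OF S, of I X] B.positive_operator_psd[OF T, of I Y]]
        XY(1,2) by simp
  qed
qed

section \<open>Nonnegativity of quantum probabilities and of the Bell expression\<close>

lemma quantum_behavior_nonneg:
  assumes "quantum_behavior d P" "a \<in> {1, 2}" "b \<in> {1, 2}" "k < d" "l < d"
  shows "P k l a b \<ge> 0"
proof -
  obtain VA ipA VB ipB V ip \<tau> \<rho> A B where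
    HA: "hilbert_space VA ipA" and HB: "hilbert_space VB ipB" and
    tp: "tensor_product VA ipA VB ipB V ip \<tau>" and
    \<rho>: "density_operator V ip \<rho>" and
    MA: "\<forall>a\<in>{1, 2}. measurement d VA ipA (A a)" and
    MB: "\<forall>b\<in>{1, 2}. measurement d VB ipB (B b)" and
    ex: "\<forall>a\<in>{1, 2}. \<forall>b\<in>{1, 2}. \<forall>k<d. \<forall>l<d. \<exists>C. tensor_operator VA VB V ip \<tau> (A a k) (B b l) C \<and>
               has_trace V ip (\<lambda>x. C (\<rho> x)) (complex_of_real (P k l a b))"
    using assms(1) unfolding quantum_behavior_def by (elim exE conjE) (rule that)
  obtain C where C: "tensor_operator VA VB V ip \<tau> (A a k) (B b l) C"
    and tr: "has_trace V ip (\<lambda>x. C (\<rho> x)) (complex_of_real (P k l a b))"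
    using ex assms(2-5) by blast
  have H: "hilbert_space V ip" using tp by (simp add: tensor_product_def)
  interpret inner_product_space scale V ip by (rule hilbert_space_inner_product_space[OF H])
  have "positive_operator VA ipA (A a k)" "positive_operator VB ipB (B b l)"
    using bspec[OF MA assms(2)] bspec[OF MB assms(3)] assms(4,5) by (auto simp: measurement_def)
  then have Cpos: "positive_operator V ip C"
    by (rule tensor_operator_positive[OF HA HB tp _ _ C])
  obtain E where E: "orthonormal_basis V ip E"
    using orthonormal_basis_exists[OF H] by blast
  have "Re (complex_of_real (P k l a b)) \<ge> 0"
    using \<rho> tr E unfolding density_operator_def has_trace_def
    by (intro trace_product_nonneg[OF Cpos _ E, of \<rho> 1]) auto
  then show ?thesis by simp
qed

lemma bell_value_nonneg:
  assumes "quantum_behavior d P"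
  shows "bell_value d P \<ge> 0"
  unfolding bell_value_def prob_A_less_B_def prob_B_less_A_def prob_B_le_A_def
  using quantum_behavior_nonneg[OF assms] by (intro add_nonneg_nonneg sum_nonneg) auto

end

section \<open>The Hilbert matrix\<close>

lemma sum_inverse_sqrt_le:
  "(\<Sum>p=1..n. 1 / sqrt (real p)) \<le> 2 * sqrt (real n)"
proof (induction n)
  case (Suc n)
  define a b where "a = sqrt (real n)" and "b = sqrt (real (Suc n))"
  have ab: "b > 0" "a \<ge> 0" "b\<^sup>2 = a\<^sup>2 + 1" by (auto simp: a_def b_def)
  have "0 \<le> (b - a)\<^sup>2" by simp
  then have "1 \<le> 2 * b * (b - a)" using ab(3) by (simp add: power2_eq_square algebra_simps)
  then have "1 / b \<le> 2 * (b - a)" using ab(1) by (simp add: field_simps)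
  then show ?case using Suc by (simp add: a_def b_def)
qed simp

lemma sum_inverse_mult_sqrt_le:
  "(\<Sum>p=1..n. 1 / (real p * sqrt (real p))) \<le> 3"
proof -
  \<comment> \<open>The first term 1 plus the integral of x^(-3/2) from 1 to n. The strengthened
    bound is what the induction carries.\<close>
  have "(\<Sum>p=1..n. 1 / (real p * sqrt (real p))) \<le> 3 - 2 / sqrt (real n)" if "n \<ge> 1"
    using that
  proof (induction n rule: dec_induct)
    case (step n)
    define a b where "a = sqrt (real n)" and "b = sqrt (real (Suc n))"
    have ab: "a > 0" "a \<le> b" "b\<^sup>2 = a\<^sup>2 + 1" "b > 0" using step by (auto simp: a_def b_def)
    have "a * a \<le> b * b" "a * b \<le> b * b" using ab by (auto intro!: mult_mono)
    then have "a * (a + b) \<le> 2 * b * b" by (simp add: algebra_simps)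
    moreover have "(b - a) * (b + a) = 1" using ab(3) by (simp add: power2_eq_square algebra_simps)
    moreover have "(2 * b * b * (b - a)) * (a + b) = 2 * b * b * ((b - a) * (b + a))"
      by (simp only: mult.assoc add.commute)
    ultimately have "a * (a + b) \<le> (2 * b * b * (b - a)) * (a + b)" by (simp only: mult_1_right)
    then have "a \<le> 2 * b * b * (b - a)"
      using ab by (auto dest: mult_right_le_imp_le)
    then have "a / (a * b * (b * b)) \<le> 2 * b * b * (b - a) / (a * b * (b * b))"
      using ab by (intro divide_right_mono) auto
    moreover have "a / (a * b * (b * b)) = 1 / (b\<^sup>2 * b)"
      using ab(1,4) by (simp add: power2_eq_square)
    moreover have "2 * b * b * (b - a) / (a * b * (b * b)) = 2 / a - 2 / b"
      using ab(1,4) by (simp add: diff_divide_distrib right_diff_distrib)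
    ultimately have "1 / (b\<^sup>2 * b) \<le> 2 / a - 2 / b" by simp
    then show ?case using step.IH by (simp add: a_def b_def)
  qed simp
  then show ?thesis
    by (cases "n \<ge> 1") (auto intro: order_trans)
qed

text \<open>Comparison with the integral of the decreasing function 1 / (sqrt x * (x + a)), whose
  antiderivative is \<open>F\<close>. Over the whole half-line the integral is
  \<open>pi / sqrt a\<close>, which is the origin of the norm of the Hilbert matrix.\<close>

lemma sum_inverse_sqrt_mult_ge:
  assumes a: "a > 0"
  shows "(\<Sum>q=1..n. 1 / (sqrt (real q) * (real q + a))) \<ge>
    2 / sqrt a * (arctan (sqrt (real (Suc n) / a)) - arctan (sqrt (1 / a)))"
proof -
  define F where "F x = 2 / sqrt a * arctan (sqrt (x / a))" for x
  have step: "F (real (Suc q)) - F (real q) \<le> 1 / (sqrt (real q) * (real q + a))" if q: "q \<ge> 1" for q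
  proof -
    have der: "(F has_real_derivative 1 / (sqrt x * (x + a))) (at x)" if "x > 0" for x
    proof -
      have pos: "sqrt a > 0" "sqrt x > 0" using a that by auto
      have "(F has_real_derivative
          2 / sqrt a * (inverse (1 + (sqrt (x / a))\<^sup>2) * ((inverse (sqrt (x / a)) / 2) * (1 / a)))) (at x)"
        unfolding F_def[abs_def]
        by (intro DERIV_cmult DERIV_chain2[OF DERIV_arctan] DERIV_chain2[OF DERIV_real_sqrt]
            DERIV_cdivide DERIV_ident) (use a that in simp)
      also have "2 / sqrt a * (inverse (1 + (sqrt (x / a))\<^sup>2) * ((inverse (sqrt (x / a)) / 2) * (1 / a))) =
          1 / (sqrt x * (x + a))"
      proof -
        have "(sqrt (x / a))\<^sup>2 = x / a" using a that by simp
        then show ?thesis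
          using a that pos by (simp add: real_sqrt_divide divide_simps)
      qed
      finally show ?thesis .
    qed
    obtain z where z: "real q < z" "z < real (Suc q)"
      "F (real (Suc q)) - F (real q) = (real (Suc q) - real q) * (1 / (sqrt z * (z + a)))"
      using MVT2[of "real q" "real (Suc q)" F "\<lambda>x. 1 / (sqrt x * (x + a))"] der q by auto
    have "1 / (sqrt z * (z + a)) \<le> 1 / (sqrt (real q) * (real q + a))"
      using z(1) q a by (intro divide_left_mono mult_mono mult_pos_pos) auto
    then show ?thesis using z(3) by simp
  qed
  have "F (real (Suc n)) - F 1 = (\<Sum>q=1..n. F (real (Suc q)) - F (real q))"
    using sum_Suc_diff[of 1 n "\<lambda>q. F (real q)"] by simp
  also have "\<dots> \<le> (\<Sum>q=1..n. 1 / (sqrt (real q) * (real q + a)))"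
    by (intro sum_mono step) auto
  finally show ?thesis by (simp add: F_def right_diff_distrib)
qed

text \<open>Row \<open>p\<close> would contribute \<open>pi / p\<close> if the comparison integral
  ran over the whole half-line. Cutting it off at \<open>Suc n\<close> and at 1 costs
  \<open>2 / (sqrt p * sqrt (Suc n))\<close> and \<open>2 / (p * sqrt p)\<close>; summed over
  \<open>p\<close> these losses are at most 4 and 6, hence the 10. The squared norm of the test
  vector is \<open>harm n\<close>, so a bounded loss is negligible.\<close>

lemma hilbert_matrix_form_ge:
  "(\<Sum>p=1..n. \<Sum>q=1..n. 1 / (sqrt (real p) * sqrt (real q) * (real p + real q))) \<ge> pi * harm n - 10"
proof -
  have inner: "(\<Sum>q=1..n. 1 / (sqrt (real p) * sqrt (real q) * (real p + real q))) \<ge>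
      pi / real p - 2 / (sqrt (real p) * sqrt (real (Suc n))) - 2 / (real p * sqrt (real p))"
    if p: "p \<ge> 1" for p
  proof -
    define s t where "s = sqrt (real p)" and "t = sqrt (real (Suc n))"
    have st: "s > 0" "t > 0" "s * s = real p" using p by (auto simp: s_def t_def)
    have "arctan (sqrt (1 / real p)) \<le> 1 / s"
      using arctan_le_self[of "sqrt (1 / real p)"] by (simp add: s_def real_sqrt_divide)
    \<comment> \<open>The reflection arctan y = pi/2 - arctan (1/y) turns the upper bound arctan x
      \<le> x into a lower bound near infinity.\<close>
    moreover have "arctan (t / s) \<ge> pi / 2 - s / t"
      using arctan_inverse[of "s / t"] arctan_le_self[of "s / t"] st by simp
    ultimately have "2 / s * (pi / 2 - s / t - 1 / s) \<le>
       2 / s * (arctan (sqrt (real (Suc n) / real p)) - arctan (sqrt (1 / real p)))"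
      using st by (intro mult_left_mono) (auto simp: s_def t_def real_sqrt_divide)
    also have "\<dots> \<le> (\<Sum>q=1..n. 1 / (sqrt (real q) * (real q + real p)))"
      unfolding s_def using p by (intro sum_inverse_sqrt_mult_ge) auto
    finally have "1 / s * (2 / s * (pi / 2 - s / t - 1 / s)) \<le>
        1 / s * (\<Sum>q=1..n. 1 / (sqrt (real q) * (real q + real p)))"
      using st by (intro mult_left_mono) auto
    also have "\<dots> = (\<Sum>q=1..n. 1 / (sqrt (real p) * sqrt (real q) * (real p + real q)))"
      by (simp add: sum_distrib_left s_def add.commute mult.assoc)
    also have "1 / s * (2 / s * (pi / 2 - s / t - 1 / s)) = pi / real p - 2 / (s * t) - 2 / (real p * s)"
      unfolding st(3)[symmetric] using st(1,2) by (simp add: field_simps)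
    finally show ?thesis by (simp add: s_def t_def)
  qed
  have "(\<Sum>p=1..n. 2 / (sqrt (real p) * sqrt (real (Suc n)))) =
      2 / sqrt (real (Suc n)) * (\<Sum>p=1..n. 1 / sqrt (real p))"
    by (simp add: sum_distrib_left mult.commute)
  also have "\<dots> \<le> 2 / sqrt (real (Suc n)) * (2 * sqrt (real (Suc n)))"
    using sum_inverse_sqrt_le[of n] by (intro mult_left_mono) (auto intro: order_trans)
  also have "\<dots> = 4" by simp
  finally have 1: "(\<Sum>p=1..n. 2 / (sqrt (real p) * sqrt (real (Suc n)))) \<le> 4" .
  have "(\<Sum>p=1..n. 2 / (real p * sqrt (real p))) = 2 * (\<Sum>p=1..n. 1 / (real p * sqrt (real p)))"
    by (simp add: sum_distrib_left)
  also have "\<dots> \<le> 6" using sum_inverse_mult_sqrt_le[of n] by simp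
  finally have 2: "(\<Sum>p=1..n. 2 / (real p * sqrt (real p))) \<le> 6" .
  have 3: "(\<Sum>p=1..n. pi / real p) = pi * harm n"
    by (simp add: harm_def sum_distrib_left divide_inverse)
  have "(\<Sum>p=1..n. pi / real p - 2 / (sqrt (real p) * sqrt (real (Suc n))) - 2 / (real p * sqrt (real p))) \<le>
    (\<Sum>p=1..n. \<Sum>q=1..n. 1 / (sqrt (real p) * sqrt (real q) * (real p + real q)))"
    by (intro sum_mono inner) auto
  then show ?thesis using 1 2 unfolding sum_subtractf 3 by linarith
qed

section \<open>Geometric sums over triangles of outcome pairs\<close>

text \<open>Here \<open>v\<close> is the inverse of \<open>w\<close>. Multiplying an inner sum by
  \<open>1 - w\<close> telescopes it to \<open>w - w ^ Suc k\<close>, and the powers of a d-th root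
  of unity other than 1 sum to 0, so only the constant \<open>w\<close> survives the sum over
  \<open>k\<close>.\<close>

lemma sum_lower_triangle:
  fixes w v :: complex
  assumes "w ^ d = 1" "w \<noteq> 1" "w * v = 1"
  shows "(\<Sum>k<d. \<Sum>l<k. w ^ k * v ^ l) = of_nat d * w / (1 - w)"
proof -
  have inner: "(1 - w) * (\<Sum>l<k. w ^ k * v ^ l) = w - w ^ Suc k" for k
  proof (induction k)
    case (Suc k)
    have "w ^ k * v ^ k = 1" using assms(3) by (simp flip: power_mult_distrib)
    then have "(\<Sum>l<Suc k. w ^ Suc k * v ^ l) = w * ((\<Sum>l<k. w ^ k * v ^ l) + 1)"
      by (simp add: algebra_simps sum_distrib_left)
    then have "(1 - w) * (\<Sum>l<Suc k. w ^ Suc k * v ^ l) = w * ((1 - w) * (\<Sum>l<k. w ^ k * v ^ l) + (1 - w))"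
      by (simp add: algebra_simps)
    then show ?case unfolding Suc by (simp add: algebra_simps)
  qed simp
  have "(\<Sum>k<d. w ^ k) = 0"
    using geometric_sum[OF assms(2), of d] assms(1) by simp
  then have "(\<Sum>k<d. w - w ^ Suc k) = of_nat d * w"
    by (simp add: sum_subtractf flip: sum_distrib_left)
  moreover have "(1 - w) * (\<Sum>k<d. \<Sum>l<k. w ^ k * v ^ l) = (\<Sum>k<d. w - w ^ Suc k)"
    by (subst sum_distrib_left) (simp only: inner)
  ultimately have "(1 - w) * (\<Sum>k<d. \<Sum>l<k. w ^ k * v ^ l) = of_nat d * w" by simp
  then show ?thesis using assms(2) by (simp add: field_simps)
qed

lemma sum_pairs_gt: "(\<Sum>(k, l)\<in>{(k, l). k < d \<and> l < d \<and> l < k}. f k l) = (\<Sum>k<d. \<Sum>l<k. f k l)"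
  for f :: "nat \<Rightarrow> nat \<Rightarrow> 'a::comm_monoid_add"
  by (subst sum.Sigma) (auto intro!: sum.cong)

lemma sum_pairs_ge: "(\<Sum>(k, l)\<in>{(k, l). k < d \<and> l < d \<and> l \<le> k}. f k l) = (\<Sum>k<d. \<Sum>l<Suc k. f k l)"
  for f :: "nat \<Rightarrow> nat \<Rightarrow> 'a::comm_monoid_add"
  by (subst sum.Sigma) (auto intro!: sum.cong)

lemma sum_pairs_lt: "(\<Sum>(k, l)\<in>{(k, l). k < d \<and> l < d \<and> k < l}. f k l) = (\<Sum>l<d. \<Sum>k<l. f k l)"
  for f :: "nat \<Rightarrow> nat \<Rightarrow> 'a::comm_monoid_add"
proof -
  have "(\<Sum>(k, l)\<in>{(k, l). k < d \<and> l < d \<and> k < l}. f k l) =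
      (\<Sum>(l, k)\<in>{(l, k). l < d \<and> k < d \<and> k < l}. f k l)"
    by (rule sum.reindex_bij_witness[of _ prod.swap prod.swap]) auto
  then show ?thesis by (simp add: sum_pairs_gt[where f = "\<lambda>l k. f k l"])
qed

section \<open>The Bell value of shifted Fourier measurements\<close>

definition alice_shift :: "nat \<Rightarrow> real" where
  "alice_shift a = (if a = 2 then 1 / 2 else 0)"

definition bob_shift :: "nat \<Rightarrow> real" where
  "bob_shift b = (if b = 2 then - 1 / 4 else 1 / 4)"

text \<open>With s the sum of the two shifts, the inner sum depends only on \<open>k - l + s\<close>
  modulo d, and for nonnegative \<open>\<alpha>\<close> its modulus is largest at 0. In every Bell
  term the value nearest to 0 modulo d has distance 1/4 from it, attained at k = l or, for s = 3/4,
  at k = l - 1 modulo d. The four events exclude these pairs, except for k = d - 1, l = 0 in the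
  last one.\<close>

definition fourier_behavior :: "nat \<Rightarrow> (nat \<Rightarrow> real) \<Rightarrow> nat \<Rightarrow> nat \<Rightarrow> nat \<Rightarrow> nat \<Rightarrow> real" where
  "fourier_behavior d \<alpha> k l a b =
     (cmod (\<Sum>j<d. of_real (\<alpha> j) *
        cis (2 * pi * real j * (real k - real l + alice_shift a + bob_shift b) / real d)))\<^sup>2 / (real d)\<^sup>2"

text \<open>The shifts sum to \<open>1/4, -1/4, 1/4, 3/4\<close> in the four terms of the Bell expression.\<close>

definition phase :: "nat \<Rightarrow> real \<Rightarrow> real \<Rightarrow> nat \<Rightarrow> nat \<Rightarrow> complex" where
  "phase d x s k l = cis (2 * pi * x * (real k - real l + s) / real d)"

text \<open>Expanding the squared modulus makes every event probability a quadratic form in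
  \<open>\<alpha>\<close>, whose kernel is a sum of phases over the event alone.\<close>

lemma fourier_behavior_sum:
  assumes "finite A"
  shows "complex_of_real (\<Sum>(k, l)\<in>A. fourier_behavior d \<alpha> k l a b) =
    (\<Sum>i<d. \<Sum>j<d. of_real (\<alpha> i * \<alpha> j / (real d)\<^sup>2) *
       (\<Sum>(k, l)\<in>A. phase d (real i - real j) (alice_shift a + bob_shift b) k l))"
proof -
  define s where "s = alice_shift a + bob_shift b"
  have "complex_of_real (fourier_behavior d \<alpha> k l a b) =
      (\<Sum>i<d. \<Sum>j<d. of_real (\<alpha> i * \<alpha> j / (real d)\<^sup>2) * phase d (real i - real j) s k l)" for k l
  proof -
    define z where "z j = complex_of_real (\<alpha> j) * cis (2 * pi * real j * (real k - real l + s) / real d)" for j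
    have "z i * cnj (z j) = of_real (\<alpha> i * \<alpha> j) * phase d (real i - real j) s k l" for i j
    proof -
      have "cis (2 * pi * real i * (real k - real l + s) / real d) *
          cis (- (2 * pi * real j * (real k - real l + s) / real d)) = phase d (real i - real j) s k l"
        unfolding cis_mult phase_def
        by (intro arg_cong[where f = cis]) (simp add: algebra_simps diff_divide_distrib add_divide_distrib)
      then show ?thesis by (simp add: z_def cis_cnj mult_ac)
    qed
    then have "(\<Sum>j<d. z j) * cnj (\<Sum>j<d. z j) =
        (\<Sum>i<d. \<Sum>j<d. of_real (\<alpha> i * \<alpha> j) * phase d (real i - real j) s k l)"
      by (simp only: cnj_sum sum_product)
    then have "complex_of_real ((cmod (\<Sum>j<d. z j))\<^sup>2) / of_real ((real d)\<^sup>2) =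
        (\<Sum>i<d. \<Sum>j<d. of_real (\<alpha> i * \<alpha> j / (real d)\<^sup>2) * phase d (real i - real j) s k l)"
      by (simp only: complex_norm_square sum_divide_distrib of_real_divide times_divide_eq_left)
    moreover have "fourier_behavior d \<alpha> k l a b = (cmod (\<Sum>j<d. z j))\<^sup>2 / (real d)\<^sup>2"
      by (simp add: fourier_behavior_def z_def s_def add.assoc)
    ultimately show ?thesis by (simp only: of_real_divide)
  qed
  then have "complex_of_real (\<Sum>p\<in>A. fourier_behavior d \<alpha> (fst p) (snd p) a b) =
      (\<Sum>p\<in>A. \<Sum>i<d. \<Sum>j<d. of_real (\<alpha> i * \<alpha> j / (real d)\<^sup>2) * phase d (real i - real j) s (fst p) (snd p))"
    by simp
  also have "\<dots> = (\<Sum>i<d. \<Sum>p\<in>A. \<Sum>j<d. of_real (\<alpha> i * \<alpha> j / (real d)\<^sup>2) * phase d (real i - real j) s (fst p) (snd p))"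
    by (rule sum.swap)
  also have "\<dots> = (\<Sum>i<d. \<Sum>j<d. \<Sum>p\<in>A. of_real (\<alpha> i * \<alpha> j / (real d)\<^sup>2) * phase d (real i - real j) s (fst p) (snd p))"
    by (intro sum.cong refl sum.swap)
  finally show ?thesis
    by (simp only: case_prod_unfold s_def sum_distrib_left)
qed

text \<open>All shifts are multiples of 1/4, so with \<open>u = cis \<theta>\<close> every phase is
  an integer power of \<open>u\<close>. The triangle sums give \<open>H = d / (u^4 - 1)\<close> and
  \<open>G + d = - d / (u^4 - 1)\<close>, and the combination collapses to
  \<open>d * (2 * u - 2 * u^3) / (u^4 - 1)\<close>, that is \<open>- 2 * d / (u + 1 / u)\<close>,
  which is \<open>- d / cos \<theta>\<close>. For \<open>i = j\<close> all phases are 1, and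
  counting pairs gives 4 * d * (d - 1) / 2 + d.\<close>

lemma phase_kernel:
  assumes "i < d" "j < d"
  defines "x \<equiv> real i - real j"
  shows "(\<Sum>l<d. \<Sum>k<l. phase d x (1/4) k l) + (\<Sum>k<d. \<Sum>l<k. phase d x (-1/4) k l) +
    (\<Sum>l<d. \<Sum>k<l. phase d x (1/4) k l) + (\<Sum>k<d. \<Sum>l<Suc k. phase d x (3/4) k l) =
    of_real ((if i = j then 2 * (real d)\<^sup>2 else 0) - real d / cos (pi * x / (2 * real d)))"
proof -
  have d: "real d > 0" using assms(1) by simp
  define \<theta> where "\<theta> = pi * x / (2 * real d)"
  define u where "u = cis \<theta>"
  define v where "v = cis (- \<theta>)"
  have uv: "u * v = 1" by (simp add: u_def v_def cis_mult)
  have ph: "phase d x s k l = cis (4 * \<theta> * s) * ((u ^ 4) ^ k * (v ^ 4) ^ l)" for s k l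
  proof -
    have "2 * pi * x * (real k - real l + s) / real d =
        4 * \<theta> * s + (real k * (real 4 * \<theta>) + real l * (real 4 * - \<theta>))"
      using d by (simp add: \<theta>_def field_simps)
    then show ?thesis
      by (simp only: phase_def u_def v_def Complex.DeMoivre cis_mult)
  qed
  have s1: "cis (4 * \<theta> * (1/4)) = u" and s2: "cis (4 * \<theta> * (-1/4)) = v"
    by (simp_all add: u_def v_def)
  have s3: "cis (4 * \<theta> * (3/4)) = u ^ 3"
    unfolding u_def Complex.DeMoivre by (simp add: mult.commute)
  define G where "G = (\<Sum>k<d. \<Sum>l<k. (u ^ 4) ^ k * (v ^ 4) ^ l)"
  define H where "H = (\<Sum>l<d. \<Sum>k<l. (u ^ 4) ^ k * (v ^ 4) ^ l)"
  have wv: "u ^ 4 * v ^ 4 = 1" using uv by (simp flip: power_mult_distrib)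
  have diag: "(\<Sum>k<d. \<Sum>l<Suc k. (u ^ 4) ^ k * (v ^ 4) ^ l) = G + of_nat d"
  proof -
    have "(u ^ 4) ^ k * (v ^ 4) ^ k = 1" for k
      using wv by (simp flip: power_mult_distrib)
    then show ?thesis by (simp add: G_def sum.distrib)
  qed
  have lhs: "(\<Sum>l<d. \<Sum>k<l. phase d x (1/4) k l) + (\<Sum>k<d. \<Sum>l<k. phase d x (-1/4) k l) +
    (\<Sum>l<d. \<Sum>k<l. phase d x (1/4) k l) + (\<Sum>k<d. \<Sum>l<Suc k. phase d x (3/4) k l) =
    u * H + v * G + u * H + u ^ 3 * (G + of_nat d)"
    unfolding ph s1 s2 s3 diag[symmetric] unfolding G_def H_def by (simp only: sum_distrib_left)
  show ?thesis
  proof (cases "i = j")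
    case True
    then have "\<theta> = 0" by (simp add: \<theta>_def x_def)
    then have uv1: "u = 1" "v = 1" by (simp_all add: u_def v_def)
    have gauss: "(\<Sum>k<d. of_nat k) = complex_of_real (((real d)\<^sup>2 - real d) / 2)"
      by (induction d) (auto simp: field_simps power2_eq_square)
    have "u * H + v * G + u * H + u ^ 3 * (G + of_nat d) = 4 * (\<Sum>k<d. of_nat k) + of_nat d"
      by (simp add: uv1 G_def H_def)
    also have "\<dots> = of_real (2 * (real d)\<^sup>2 - real d)"
      unfolding gauss by (simp add: diff_divide_distrib)
    finally have "u * H + v * G + u * H + u ^ 3 * (G + of_nat d) = of_real (2 * (real d)\<^sup>2 - real d)" .
    then show ?thesis unfolding lhs using True \<open>\<theta> = 0\<close> by (simp flip: \<theta>_def)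
  next
    case False
    have xd: "\<bar>x\<bar> < real d" using assms by (auto simp: x_def)
    then have "\<bar>\<theta>\<bar> < pi / 2" using d by (simp add: \<theta>_def abs_mult field_simps)
    then have cpos: "cos \<theta> > 0" by (intro cos_gt_zero_pi) auto
    \<comment> \<open>Together with \<open>cos \<theta> > 0\<close> this keeps both factors of
      \<open>u ^ 4 - 1\<close> away from 0; it holds because 0 < |\<theta>| < pi/2 off the
      diagonal.\<close>
    have u2: "u\<^sup>2 \<noteq> 1"
    proof
      assume "u\<^sup>2 = 1"
      then have "u * u = u * v" using uv by (simp add: power2_eq_square)
      moreover have "u \<noteq> 0" using uv by auto
      ultimately have "Im u = Im v" by simp
      then have "sin \<theta> = 0" by (simp add: u_def v_def)
      then have "sin \<bar>\<theta>\<bar> = 0" by (auto simp: abs_if)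
      moreover have "\<bar>\<theta>\<bar> > 0" using False d by (auto simp: \<theta>_def x_def)
      ultimately show False using sin_gt_zero2[of "\<bar>\<theta>\<bar>"] \<open>\<bar>\<theta>\<bar> < pi / 2\<close> by linarith
    qed
    have uc: "u + v = of_real (2 * cos \<theta>)"
      by (simp add: u_def v_def complex_eq_iff)
    have u0: "u \<noteq> 0" using uv by auto
    have "u\<^sup>2 + 1 = u * (u + v)" using uv by (simp add: power2_eq_square algebra_simps)
    then have u2': "u\<^sup>2 + 1 \<noteq> 0" using u0 cpos by (simp add: uc)
    have u4: "u ^ 4 - 1 = (u\<^sup>2 - 1) * (u\<^sup>2 + 1)"
      by (simp add: algebra_simps flip: power_add)
    then have w1: "u ^ 4 \<noteq> 1" using u2 u2' by auto
    then have v1: "v ^ 4 \<noteq> 1" using wv by auto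
    have wd: "(u ^ 4) ^ d = 1"
    proof -
      have "(u ^ 4) ^ d = cis (2 * pi * of_int (int i - int j))"
        unfolding u_def Complex.DeMoivre \<theta>_def x_def using d by (intro arg_cong[where f = cis]) (simp add: field_simps)
      then show ?thesis by (simp only: cis_multiple_2pi Ints_of_int)
    qed
    have vd: "(v ^ 4) ^ d = 1"
      using wv wd by (metis power_mult_distrib power_one mult_1)
    have G: "G = of_nat d * u ^ 4 / (1 - u ^ 4)"
      unfolding G_def by (rule sum_lower_triangle[OF wd w1 wv])
    have "H = (\<Sum>l<d. \<Sum>k<l. (v ^ 4) ^ l * (u ^ 4) ^ k)"
      by (simp add: H_def mult.commute)
    also have "\<dots> = of_nat d * v ^ 4 / (1 - v ^ 4)"
      using wv by (intro sum_lower_triangle[OF vd v1]) (simp add: mult.commute)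
    also have "\<dots> = of_nat d / (u ^ 4 - 1)"
    proof -
      have "v ^ 4 * (u ^ 4 - 1) = 1 - v ^ 4" using wv by (simp add: algebra_simps)
      then show ?thesis using w1 v1 by (simp add: frac_eq_eq mult_ac)
    qed
    finally have H: "H = of_nat d / (u ^ 4 - 1)" .
    have G': "G = - (of_nat d * u ^ 4 / (u ^ 4 - 1))"
      unfolding G minus_divide_right by simp
    have Gd: "G + of_nat d = - (of_nat d / (u ^ 4 - 1))"
      unfolding G' using w1 by (simp add: divide_simps) (simp add: algebra_simps)
    have "v * G = - (of_nat d * u ^ 3 / (u ^ 4 - 1))"
    proof -
      have "v * u ^ 4 = u ^ 3" using uv by (simp add: eval_nat_numeral mult_ac)
      then show ?thesis unfolding G' by (simp add: mult_ac)
    qed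
    then have "u * H + v * G + u * H + u ^ 3 * (G + of_nat d) =
        of_nat d * (2 * u - 2 * u ^ 3) / (u ^ 4 - 1)"
      unfolding H Gd using w1 by (simp add: divide_simps) (simp add: algebra_simps)
    also have "\<dots> = - (of_nat d * (2 * u)) / (u\<^sup>2 + 1)"
      unfolding u4 using u2 u2' by (simp add: divide_simps) (simp add: algebra_simps power2_eq_square power3_eq_cube)
    also have "\<dots> = - (of_nat d * 2) / (u + v)"
      unfolding \<open>u\<^sup>2 + 1 = u * (u + v)\<close> using u0 by simp
    also have "\<dots> = of_real (- real d / cos \<theta>)"
      unfolding uc using cpos by simp
    finally show ?thesis unfolding lhs using False by (simp flip: \<theta>_def)
  qed
qed

theorem bell_value_fourier_behavior:
  "bell_value d (fourier_behavior d \<alpha>) = 2 * (\<Sum>j<d. (\<alpha> j)\<^sup>2) -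
     (\<Sum>i<d. \<Sum>j<d. \<alpha> i * \<alpha> j / cos (pi * (real i - real j) / (2 * real d))) / real d"
proof -
  define K where "K i j = (if i = j then 2 * (real d)\<^sup>2 else 0) -
      real d / cos (pi * (real i - real j) / (2 * real d))" for i j
  have fin: "finite {(k, l). k < d \<and> l < d \<and> R k l}" for R
    by (rule finite_subset[of _ "{..<d} \<times> {..<d}"]) auto
  have shifts: "alice_shift 2 + bob_shift 2 = 1/4" "alice_shift 1 + bob_shift 2 = -1/4"
    "alice_shift 1 + bob_shift 1 = 1/4" "alice_shift 2 + bob_shift 1 = 3/4"
    by (simp_all add: alice_shift_def bob_shift_def)
  have "(\<Sum>i<d. \<Sum>j<d. of_real (\<alpha> i * \<alpha> j / (real d)\<^sup>2) * complex_of_real (K i j)) =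
      (\<Sum>i<d. \<Sum>j<d. of_real (\<alpha> i * \<alpha> j / (real d)\<^sup>2) *
       ((\<Sum>l<d. \<Sum>k<l. phase d (real i - real j) (1/4) k l) +
        (\<Sum>k<d. \<Sum>l<k. phase d (real i - real j) (-1/4) k l) +
        (\<Sum>l<d. \<Sum>k<l. phase d (real i - real j) (1/4) k l) +
        (\<Sum>k<d. \<Sum>l<Suc k. phase d (real i - real j) (3/4) k l)))"
    unfolding K_def by (intro sum.cong refl arg_cong2[where f = "(*)"] phase_kernel[symmetric]) auto
  also have "\<dots> = complex_of_real (bell_value d (fourier_behavior d \<alpha>))"
    unfolding bell_value_def prob_A_less_B_def prob_B_less_A_def prob_B_le_A_def of_real_add
    unfolding fourier_behavior_sum[OF fin] shifts
    unfolding sum_pairs_lt sum_pairs_gt sum_pairs_ge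
    by (simp only: distrib_left sum.distrib)
  finally have "complex_of_real (bell_value d (fourier_behavior d \<alpha>)) =
     (\<Sum>i<d. \<Sum>j<d. of_real (\<alpha> i * \<alpha> j / (real d)\<^sup>2) * of_real (K i j))" ..
  also have "\<dots> = of_real (\<Sum>i<d. \<Sum>j<d. \<alpha> i * \<alpha> j / (real d)\<^sup>2 * K i j)"
    by simp
  finally have "bell_value d (fourier_behavior d \<alpha>) = (\<Sum>i<d. \<Sum>j<d. \<alpha> i * \<alpha> j / (real d)\<^sup>2 * K i j)"
    by (simp only: of_real_eq_iff)
  also have "\<dots> = (\<Sum>i<d. \<Sum>j<d. (if j = i then 2 * (\<alpha> i)\<^sup>2 else 0) -
      \<alpha> i * \<alpha> j / cos (pi * (real i - real j) / (2 * real d)) / real d)"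
  proof (intro sum.cong refl)
    fix i j assume "i \<in> {..<d}"
    then have d: "real d > 0" by auto
    show "\<alpha> i * \<alpha> j / (real d)\<^sup>2 * K i j = (if j = i then 2 * (\<alpha> i)\<^sup>2 else 0) -
      \<alpha> i * \<alpha> j / cos (pi * (real i - real j) / (2 * real d)) / real d"
      using d by (cases "i = j") (simp_all add: K_def right_diff_distrib power2_eq_square)
  qed
  finally show ?thesis
    by (simp add: sum_subtractf sum_divide_distrib sum_distrib_left)
qed

section \<open>Amplitudes with small Bell value\<close>

text \<open>The amplitude at distance p from either end of the range is proportional to 1 / sqrt p.
  The two cross blocks, left against right and right against left, each contribute at least
  \<open>2 * d / pi\<close> times the Hilbert form; all other entries are nonnegative and are
  dropped. The squared norm before scaling is \<open>2 * h\<close>, so the value is at most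
  \<open>2 - (4 * h - 40 / pi) / (2 * h)\<close>. The condition \<open>2 * n \<le> d\<close> keeps
  the two ends disjoint.\<close>

lemma fourier_bell_value_small:
  assumes n: "n \<ge> 1" "2 * n \<le> d"
  shows "\<exists>\<alpha>. (\<Sum>j<d. (\<alpha> j)\<^sup>2) = 1 \<and> bell_value d (fourier_behavior d \<alpha>) \<le> 20 / (pi * harm n)"
proof -
  define h :: real where "h = harm n"
  have h: "h > 0" using n by (simp add: h_def harm_pos)
  have d: "real d > 0" using n by simp
  define L R where "L = {..<n}" and "R = {d-n..<d}"
  have LR: "finite L" "finite R" "L \<inter> R = {}" "L \<union> R \<subseteq> {..<d}"
    using n by (auto simp: L_def R_def)
  have sumL: "sum g L = (\<Sum>p=1..n. g (p - 1))" for g :: "nat \<Rightarrow> real"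
    unfolding L_def by (rule sum.reindex_bij_witness[of _ "\<lambda>p. p - 1" Suc]) auto
  have sumR: "sum g R = (\<Sum>p=1..n. g (d - p))" for g :: "nat \<Rightarrow> real"
    unfolding R_def by (rule sum.reindex_bij_witness[of _ "\<lambda>p. d - p" "\<lambda>j. d - j"]) (use n in auto)
  define \<beta> where "\<beta> j = (if j \<in> L then 1 / sqrt (real (Suc j)) else if j \<in> R then 1 / sqrt (real (d - j)) else 0)" for j
  have \<beta>L: "\<beta> (p - 1) = 1 / sqrt (real p)" if "p \<in> {1..n}" for p
    using that by (auto simp: \<beta>_def L_def)
  have \<beta>R: "\<beta> (d - p) = 1 / sqrt (real p)" if "p \<in> {1..n}" for p
  proof -
    have "d - p \<in> R" "d - p \<notin> L" "d - (d - p) = p" using that n by (auto simp: L_def R_def)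
    then show ?thesis by (simp add: \<beta>_def)
  qed
  have \<beta>0: "\<beta> j \<ge> 0" for j by (simp add: \<beta>_def)
  have h_sum: "(\<Sum>p=1..n. (1 / sqrt (real p))\<^sup>2) = h"
    unfolding h_def harm_def by (intro sum.cong) (auto simp: power_divide inverse_eq_divide)
  have norm\<beta>: "(\<Sum>j<d. (\<beta> j)\<^sup>2) = 2 * h"
  proof -
    have "(\<Sum>j<d. (\<beta> j)\<^sup>2) = (\<Sum>j\<in>L \<union> R. (\<beta> j)\<^sup>2)"
      using LR(4) by (intro sum.mono_neutral_right) (auto simp: \<beta>_def)
    also have "\<dots> = (\<Sum>j\<in>L. (\<beta> j)\<^sup>2) + (\<Sum>j\<in>R. (\<beta> j)\<^sup>2)"
      using LR by (intro sum.union_disjoint)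
    also have "\<dots> = (\<Sum>p=1..n. (1 / sqrt (real p))\<^sup>2) + (\<Sum>p=1..n. (1 / sqrt (real p))\<^sup>2)"
      unfolding sumL sumR by (intro arg_cong2[where f = "(+)"] sum.cong refl) (simp_all only: \<beta>L \<beta>R)
    finally show ?thesis unfolding h_sum by simp
  qed
  define K where "K i j = \<beta> i * \<beta> j / cos (pi * (real i - real j) / (2 * real d))" for i j
  define Hil where "Hil = (\<Sum>p=1..n. \<Sum>q=1..n. 1 / (sqrt (real p) * sqrt (real q) * (real p + real q)))"
  have K_nonneg: "K i j \<ge> 0" if "i < d" "j < d" for i j
  proof -
    define x where "x = real i - real j"
    have "\<bar>x\<bar> < real d" using that by (auto simp: x_def)
    then have "\<bar>pi * x / (2 * real d)\<bar> < pi / 2"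
      using d by (simp add: abs_mult field_simps)
    then have "cos (pi * x / (2 * real d)) > 0"
      by (intro cos_gt_zero_pi) linarith+
    then show ?thesis using \<beta>0 by (simp add: K_def x_def)
  qed
  have K_sym: "K i j = K j i" for i j
  proof -
    have "pi * (real i - real j) / (2 * real d) = - (pi * (real j - real i) / (2 * real d))"
      by (simp add: diff_divide_distrib right_diff_distrib)
    then show ?thesis by (simp only: K_def cos_minus mult.commute[of "\<beta> i"])
  qed
  have K_ge: "K (p - 1) (d - q) \<ge> 2 * real d / pi * (1 / (sqrt (real p) * sqrt (real q) * (real p + real q)))"
    if pq: "p \<in> {1..n}" "q \<in> {1..n}" for p q
  proof -
    \<comment> \<open>For the indices \<open>p - 1\<close> and \<open>d - q\<close> the angle
      differs from -pi/2 by \<open>t\<close>, so the cosine becomes \<open>sin t\<close>. Then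
      \<open>sin t \<le> t\<close>, and dropping the \<open>- 1\<close> leaves the denominator p + q
      of the Hilbert matrix.\<close>
    define t where "t = pi * (real p + real q - 1) / (2 * real d)"
    have "pi * (real (p - 1) - real (d - q)) / (2 * real d) = - (pi / 2 - t)"
      using pq n d by (simp add: t_def of_nat_diff field_simps)
    then have c: "cos (pi * (real (p - 1) - real (d - q)) / (2 * real d)) = sin t"
      by (simp only: cos_minus) (simp add: cos_diff)
    have t: "t > 0" using pq d by (simp add: t_def)
    have "real p + real q - 1 < 2 * real d" using pq n by simp
    then have "(real p + real q - 1) / (2 * real d) < 1" using d by simp
    then have "pi * ((real p + real q - 1) / (2 * real d)) < pi * 1"
      by (intro mult_strict_left_mono) auto
    then have "t < pi" by (simp add: t_def)
    then have "sin t > 0" using t by (rule sin_gt_zero[rotated])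
    moreover have "sin t \<le> pi * (real p + real q) / (2 * real d)"
    proof -
      have "sin t \<le> t" using t by (simp add: sin_x_le_x)
      also have "t \<le> pi * (real p + real q) / (2 * real d)"
        unfolding t_def using d by (intro divide_right_mono mult_left_mono) auto
      finally show ?thesis .
    qed
    ultimately have "1 / (pi * (real p + real q) / (2 * real d)) \<le> 1 / sin t"
      by (intro divide_left_mono mult_pos_pos) auto
    then have "1 / (sqrt (real p) * sqrt (real q)) * (1 / (pi * (real p + real q) / (2 * real d))) \<le>
        1 / (sqrt (real p) * sqrt (real q)) * (1 / sin t)"
      by (intro mult_left_mono) auto
    then show ?thesis unfolding K_def c \<beta>L[OF pq(1)] \<beta>R[OF pq(2)] by (simp add: mult_ac)
  qed
  have LR_ge: "(\<Sum>i\<in>L. \<Sum>j\<in>R. K i j) \<ge> 2 * real d / pi * Hil"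
    unfolding sumL sumR Hil_def sum_distrib_left by (intro sum_mono K_ge)
  have "(\<Sum>i\<in>L. \<Sum>j\<in>R. K i j) + (\<Sum>i\<in>R. \<Sum>j\<in>L. K i j) \<le> (\<Sum>i\<in>L. \<Sum>j<d. K i j) + (\<Sum>i\<in>R. \<Sum>j<d. K i j)"
    using LR(4) by (intro add_mono sum_mono sum_mono2 K_nonneg) auto
  also have "\<dots> = (\<Sum>i\<in>L \<union> R. \<Sum>j<d. K i j)"
    using LR by (intro sum.union_disjoint[symmetric])
  also have "\<dots> \<le> (\<Sum>i<d. \<Sum>j<d. K i j)"
    using LR(4) by (intro sum_mono2 sum_nonneg K_nonneg) auto
  also have "(\<Sum>i\<in>R. \<Sum>j\<in>L. K i j) = (\<Sum>i\<in>L. \<Sum>j\<in>R. K i j)"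
    by (subst sum.swap) (simp only: K_sym)
  finally have "4 * real d / pi * Hil \<le> (\<Sum>i<d. \<Sum>j<d. K i j)"
    using LR_ge by simp
  moreover have "4 * real d / pi * (pi * h - 10) \<le> 4 * real d / pi * Hil"
    using hilbert_matrix_form_ge[of n] d by (intro mult_left_mono) (auto simp: Hil_def h_def)
  ultimately have "4 * real d / pi * (pi * h - 10) \<le> (\<Sum>i<d. \<Sum>j<d. K i j)" by linarith
  then have "4 * real d / pi * (pi * h - 10) / real d \<le> (\<Sum>i<d. \<Sum>j<d. K i j) / real d"
    using d by (intro divide_right_mono) auto
  moreover have "4 * real d / pi * (pi * h - 10) / real d = 4 * h - 40 / pi"
    using d by (simp add: field_simps)
  ultimately have K_sum: "(\<Sum>i<d. \<Sum>j<d. K i j) / real d \<ge> 4 * h - 40 / pi" by simp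
  define c where "c = 1 / sqrt (2 * h)"
  have c2: "c\<^sup>2 = 1 / (2 * h)" using h by (simp add: c_def power_divide)
  have norm1: "(\<Sum>j<d. (c * \<beta> j)\<^sup>2) = 1"
    unfolding power_mult_distrib sum_distrib_left[symmetric] norm\<beta> c2 using h by simp
  have "(\<Sum>i<d. \<Sum>j<d. c * \<beta> i * (c * \<beta> j) / cos (pi * (real i - real j) / (2 * real d))) =
      c\<^sup>2 * (\<Sum>i<d. \<Sum>j<d. K i j)"
    by (simp add: K_def sum_distrib_left power2_eq_square mult_ac)
  then have "bell_value d (fourier_behavior d (\<lambda>j. c * \<beta> j)) =
      2 - c\<^sup>2 * ((\<Sum>i<d. \<Sum>j<d. K i j) / real d)"
    unfolding bell_value_fourier_behavior norm1 by simp
  also have "\<dots> \<le> 2 - c\<^sup>2 * (4 * h - 40 / pi)"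
    using K_sum by (intro diff_left_mono mult_left_mono) auto
  also have "\<dots> = 20 / (pi * h)"
    unfolding c2 using h by (simp add: field_simps)
  finally show ?thesis
    using norm1 unfolding h_def by (intro exI[of _ "\<lambda>j. c * \<beta> j"] conjI)
qed

section \<open>Realization in finite-dimensional Hilbert spaces\<close>

context inner_product_space begin

abbreviation rank_one :: "'v \<Rightarrow> 'v \<Rightarrow> 'v \<Rightarrow> 'v" where
  "rank_one u v \<equiv> (\<lambda>x. ip u x *C v)"

lemma bounded_operator_rank_one:
  assumes "u \<in> V" "v \<in> V"
  shows "bounded_operator V ip (rank_one u v)"
proof -
  have "vnorm (ip u x *C v) \<le> (vnorm u * vnorm v) * vnorm x" if "x \<in> V" for x
    using mult_right_mono[OF cauchy_schwarz[OF assms(1) that] vnorm_nonneg[OF assms(2)]] assms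
    by (simp add: vnorm_scale mult_ac)
  then show ?thesis
    using assms unfolding bounded_operator_def
    by (auto simp: scale_left_distrib intro!: exI[of _ "vnorm u * vnorm v"])
qed

lemma positive_operator_rank_one:
  assumes "u \<in> V"
  shows "positive_operator V ip (rank_one u u)"
proof -
  have "ip x (ip u x *C u) = of_real ((cmod (ip u x))\<^sup>2)" if "x \<in> V" for x
    using that assms ip_commute[of u x] by (simp add: complex_norm_square del: of_real_power)
  then show ?thesis
    using bounded_operator_rank_one[OF assms assms] by (simp add: positive_operator_def)
qed

lemma has_trace_rank_one:
  assumes "u \<in> V" "v \<in> V"
  shows "has_trace V ip (rank_one u v) (ip u v)"
  unfolding has_trace_def
proof (intro allI impI)
  fix E assume E: "orthonormal_basis V ip E"
  have "((\<lambda>e. ip u e * ip e v) has_sum ip u v) E" by (rule parseval[OF E assms])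
  moreover have "ip e (ip u e *C v) = ip u e * ip e v" if "e \<in> E" for e
    using E that assms by (auto simp: orthonormal_basis_iff orthonormal_def)
  ultimately show "((\<lambda>e. ip e (ip u e *C v)) has_sum ip u v) E"
    by (simp cong: has_sum_cong)
qed

lemma measurement_rank_one:
  assumes "\<And>k. k < d \<Longrightarrow> v k \<in> V" "\<And>x. x \<in> V \<Longrightarrow> (\<Sum>k<d. ip (v k) x *C v k) = x"
  shows "measurement d V ip (\<lambda>k. rank_one (v k) (v k))"
  using assms positive_operator_rank_one by (simp add: measurement_def)

end

context complex_vector_space begin

text \<open>A pure state with rank one effects. The product of \<open>rank_one \<phi> \<phi>\<close>
  with the state is again of rank one, and its trace is the squared modulus of
  \<open>ip \<phi> \<psi>\<close>.\<close>

lemma quantum_behavior_rank_one: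
  assumes HA: "hilbert_space VA ipA" and HB: "hilbert_space VB ipB"
    and tp: "tensor_product VA ipA VB ipB V ip \<tau>"
    and \<psi>: "\<psi> \<in> V" "ip \<psi> \<psi> = 1"
    and u: "\<And>a k. k < d \<Longrightarrow> u a k \<in> VA" "\<And>a x. x \<in> VA \<Longrightarrow> (\<Sum>k<d. ipA (u a k) x *C u a k) = x"
    and v: "\<And>b l. l < d \<Longrightarrow> v b l \<in> VB" "\<And>b y. y \<in> VB \<Longrightarrow> (\<Sum>l<d. ipB (v b l) y *C v b l) = y"
    and P: "\<And>k l a b. k < d \<Longrightarrow> l < d \<Longrightarrow> P k l a b = (cmod (ip (\<tau> (u a k) (v b l)) \<psi>))\<^sup>2"
  shows "quantum_behavior d P"
proof -
  have H: "hilbert_space V ip" using tp by (simp add: tensor_product_def)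
  interpret A: inner_product_space scale VA ipA by (rule hilbert_space_inner_product_space[OF HA])
  interpret B: inner_product_space scale VB ipB by (rule hilbert_space_inner_product_space[OF HB])
  interpret inner_product_space scale V ip by (rule hilbert_space_inner_product_space[OF H])
  have \<tau>V: "\<tau> x y \<in> V" if "x \<in> VA" "y \<in> VB" for x y
    using tp that unfolding tensor_product_def dense_span_def by blast
  have \<tau>_ip: "ip (\<tau> x y) (\<tau> x' y') = ipA x x' * ipB y y'"
    if "x \<in> VA" "x' \<in> VA" "y \<in> VB" "y' \<in> VB" for x x' y y'
    using tp that by (simp add: tensor_product_def)
  have \<tau>_scale: "\<tau> (c *C x) y = c *C \<tau> x y" "\<tau> x (c *C y) = c *C \<tau> x y" if "x \<in> VA" "y \<in> VB" for c x y
    using tp that by (simp_all add: tensor_product_def)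
  define \<rho> where "\<rho> = rank_one \<psi> \<psi>"
  have \<rho>: "density_operator V ip \<rho>"
    unfolding density_operator_def \<rho>_def
    using positive_operator_rank_one[OF \<psi>(1)] has_trace_rank_one[OF \<psi>(1) \<psi>(1)] \<psi>(2) by simp
  have C: "\<exists>C. tensor_operator VA VB V ip \<tau> (A.rank_one (u a k) (u a k)) (B.rank_one (v b l) (v b l)) C \<and>
      has_trace V ip (\<lambda>x. C (\<rho> x)) (complex_of_real (P k l a b))" if kl: "k < d" "l < d" for a b k l
  proof (intro exI conjI)
    define \<phi> where "\<phi> = \<tau> (u a k) (v b l)"
    have \<phi>V: "\<phi> \<in> V" using u(1) v(1) kl \<tau>V by (simp add: \<phi>_def)
    show "tensor_operator VA VB V ip \<tau> (A.rank_one (u a k) (u a k)) (B.rank_one (v b l) (v b l)) (rank_one \<phi> \<phi>)"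
      unfolding tensor_operator_def
      using bounded_operator_rank_one[OF \<phi>V \<phi>V] u(1) v(1) kl
      by (auto simp: \<phi>_def \<tau>_ip \<tau>_scale mult.commute)
    have "has_trace V ip (rank_one \<psi> (ip \<phi> \<psi> *C \<phi>)) (ip \<psi> (ip \<phi> \<psi> *C \<phi>))"
      using \<psi>(1) \<phi>V by (intro has_trace_rank_one) auto
    moreover have "ip \<psi> (ip \<phi> \<psi> *C \<phi>) = complex_of_real (P k l a b)"
      unfolding P[OF kl] complex_norm_square using \<psi>(1) \<phi>V ip_commute[of \<phi> \<psi>] by (simp add: \<phi>_def)
    \<comment> \<open>The two operators are compared only on basis vectors: the rules for
      \<open>ip\<close> hold on \<open>V\<close>, not on the whole ambient space.\<close>
    moreover have "has_trace V ip (\<lambda>x. rank_one \<phi> \<phi> (\<rho> x)) t = has_trace V ip (rank_one \<psi> (ip \<phi> \<psi> *C \<phi>)) t" for t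
      unfolding has_trace_def
    proof (intro all_cong1 imp_cong refl has_sum_cong)
      fix E e assume E: "orthonormal_basis V ip E" and e: "e \<in> E"
      then have "e \<in> V" by (auto simp: orthonormal_basis_iff orthonormal_def)
      then show "ip e (rank_one \<phi> \<phi> (\<rho> e)) = ip e (ip \<psi> e *C ip \<phi> \<psi> *C \<phi>)"
        using \<phi>V \<psi>(1) by (simp add: \<rho>_def)
    qed
    ultimately show "has_trace V ip (\<lambda>x. rank_one \<phi> \<phi> (\<rho> x)) (complex_of_real (P k l a b))"
      by simp
  qed
  have MA: "measurement d VA ipA (\<lambda>k. A.rank_one (u a k) (u a k))" for a
    using u by (rule A.measurement_rank_one)
  have MB: "measurement d VB ipB (\<lambda>l. B.rank_one (v b l) (v b l))" for b
    using v by (rule B.measurement_rank_one)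
  show ?thesis
    unfolding quantum_behavior_def
    by (rule exI[of _ VA], rule exI[of _ ipA], rule exI[of _ VB], rule exI[of _ ipB],
        rule exI[of _ V], rule exI[of _ ip], rule exI[of _ \<tau>], rule exI[of _ \<rho>],
        rule exI[of _ "\<lambda>a k. A.rank_one (u a k) (u a k)"],
        rule exI[of _ "\<lambda>b l. B.rank_one (v b l) (v b l)"])
      (use HA HB tp \<rho> MA MB C in simp)
qed

end

section \<open>Coordinate Hilbert spaces inside the ambient space\<close>

text \<open>A copy of the standard space of complex families over \<open>I\<close>: the ambient
  space has no inner product, so an independent family is simply declared orthonormal through
  \<open>cip\<close>.\<close>

locale finite_basis = complex_vector_space scale
  for scale :: "complex \<Rightarrow> 'v::ab_group_add \<Rightarrow> 'v" (infixr "*C" 75) +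
  fixes I :: "'i set" and b :: "'i \<Rightarrow> 'v"
  assumes finite_I: "finite I" and inj_b: "inj_on b I" and independent_b: "independent (b ` I)"
begin

definition W :: "'v set" where "W = span (b ` I)"

definition vec :: "('i \<Rightarrow> complex) \<Rightarrow> 'v" where "vec c = (\<Sum>i\<in>I. c i *C b i)"

definition coord :: "'i \<Rightarrow> 'v \<Rightarrow> complex" where "coord i x = representation (b ` I) x (b i)"

definition cip :: "'v \<Rightarrow> 'v \<Rightarrow> complex" where "cip x y = (\<Sum>i\<in>I. cnj (coord i x) * coord i y)"

lemma vec_in_W [simp]: "vec c \<in> W"
  unfolding vec_def W_def by (intro span_sum span_scale span_base) auto

lemma subspace_W: "subspace W"
  by (simp add: W_def)

lemma coord_add: "x \<in> W \<Longrightarrow> y \<in> W \<Longrightarrow> coord i (x + y) = coord i x + coord i y"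
  using representation_add[OF independent_b] by (simp add: coord_def W_def)

lemma coord_scale: "x \<in> W \<Longrightarrow> coord i (c *C x) = c * coord i x"
  using representation_scale[OF independent_b] by (simp add: coord_def W_def)

lemma coord_b: "i \<in> I \<Longrightarrow> j \<in> I \<Longrightarrow> coord i (b j) = (if i = j then 1 else 0)"
  using representation_basis[OF independent_b, of "b j"] inj_b by (auto simp: coord_def inj_on_def)

lemma b_in_W: "i \<in> I \<Longrightarrow> b i \<in> W"
  unfolding W_def by (intro span_base) auto

lemma coord_zero: "coord i 0 = 0"
  by (simp add: coord_def representation_zero)

lemma coord_sum:
  assumes "\<And>t. t \<in> T \<Longrightarrow> f t \<in> W"
  shows "coord i (sum f T) = (\<Sum>t\<in>T. coord i (f t))"
  using assms
proof (induction T rule: infinite_finite_induct)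
  case (insert t T)
  have "sum f T \<in> W" using insert by (intro subspace_sum[OF subspace_W]) auto
  then show ?case using insert by (simp add: coord_add)
qed (simp_all add: coord_zero)

lemma coord_vec: "i \<in> I \<Longrightarrow> coord i (vec c) = c i"
proof -
  assume i: "i \<in> I"
  have "coord i (vec c) = (\<Sum>j\<in>I. coord i (c j *C b j))"
    unfolding vec_def by (rule coord_sum) (simp add: b_in_W subspace_scale[OF subspace_W])
  also have "\<dots> = (\<Sum>j\<in>I. if j = i then c j else 0)"
    using i by (intro sum.cong refl) (simp add: coord_scale b_in_W coord_b)
  finally show ?thesis using i finite_I by simp
qed

lemma vec_coord:
  assumes "x \<in> W"
  shows "vec (\<lambda>i. coord i x) = x"
proof -
  have "x \<in> span (b ` I)" using assms by (simp add: W_def)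
  then have "(\<Sum>v\<in>b ` I. representation (b ` I) x v *C v) = x"
    by (intro sum_representation_eq[OF independent_b]) (auto simp: finite_I)
  then show ?thesis by (simp add: vec_def coord_def sum.reindex[OF inj_b])
qed

lemma W_eqI:
  assumes "x \<in> W" "y \<in> W" "\<And>i. i \<in> I \<Longrightarrow> coord i x = coord i y"
  shows "x = y"
proof -
  have "vec (\<lambda>i. coord i x) = vec (\<lambda>i. coord i y)"
    unfolding vec_def using assms(3) by simp
  then show ?thesis using assms by (simp add: vec_coord)
qed

lemma cip_self: "cip x x = of_real (\<Sum>i\<in>I. (cmod (coord i x))\<^sup>2)"
  by (simp add: cip_def complex_norm_square mult.commute del: of_real_power)

lemma inner_product_on_W: "inner_product_on W cip"
  unfolding inner_product_on_def
proof (intro conjI ballI allI impI)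
  fix x y z c assume xyz: "x \<in> W" "y \<in> W" 
  show "cip x (c *C y) = c * cip x y"
    using xyz by (simp add: cip_def coord_scale sum_distrib_left mult_ac)
  show "cip y x = cnj (cip x y)" by (simp add: cip_def mult.commute)
  show "cip x (y + z) = cip x y + cip x z" if "z \<in> W"
    using xyz that by (simp add: cip_def coord_add sum.distrib distrib_left)
next
  fix x assume x: "x \<in> W" "x \<noteq> 0"
  then obtain i where i: "i \<in> I" "coord i x \<noteq> 0"
    using W_eqI[of x 0] subspace_0[OF subspace_W] by (auto simp: coord_zero)
  then have "(\<Sum>i\<in>I. (cmod (coord i x))\<^sup>2) > 0"
    using finite_I by (intro sum_pos2[of I i]) auto
  then show "Re (cip x x) > 0" by (simp add: cip_self)
qed

sublocale inner_product_space scale W cip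
  by unfold_locales (auto simp: subspace_W inner_product_on_W)

lemma vnorm_eq: "vnorm x = sqrt (\<Sum>i\<in>I. (cmod (coord i x))\<^sup>2)"
  by (simp add: hnorm_def cip_self)

lemma coord_diff: "x \<in> W \<Longrightarrow> y \<in> W \<Longrightarrow> coord i (x - y) = coord i x - coord i y"
  using coord_add[of "x - y" y i] by simp

lemma coord_le_vnorm:
  assumes "i \<in> I"
  shows "cmod (coord i x) \<le> vnorm x"
proof -
  have "(cmod (coord i x))\<^sup>2 \<le> (\<Sum>i\<in>I. (cmod (coord i x))\<^sup>2)"
    using assms finite_I by (intro member_le_sum) auto
  then show ?thesis unfolding vnorm_eq by (rule real_le_rsqrt)
qed

lemma hilbert_space_W: "hilbert_space W cip"
  unfolding hilbert_space_def
proof (intro conjI allI impI)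
  fix X :: "nat \<Rightarrow> 'v"
  assume X: "(\<forall>n. X n \<in> W) \<and> (\<forall>e>0. \<exists>N. \<forall>m\<ge>N. \<forall>n\<ge>N. vnorm (X m - X n) < e)"
  have "convergent (\<lambda>n. coord i (X n))" if i: "i \<in> I" for i
  proof (rule Cauchy_convergent, rule metric_CauchyI)
    fix e :: real assume "e > 0"
    then obtain N where N: "\<And>m n. m \<ge> N \<Longrightarrow> n \<ge> N \<Longrightarrow> vnorm (X m - X n) < e" using X by meson
    have "dist (coord i (X m)) (coord i (X n)) < e" if "m \<ge> N" "n \<ge> N" for m n
      using N[OF that] coord_le_vnorm[OF i, of "X m - X n"] X by (simp add: coord_diff dist_norm)
    then show "\<exists>M. \<forall>m\<ge>M. \<forall>n\<ge>M. dist (coord i (X m)) (coord i (X n)) < e" by blast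
  qed
  then have "\<forall>i\<in>I. \<exists>l. (\<lambda>n. coord i (X n)) \<longlonglongrightarrow> l" by (auto simp: convergent_def)
  then obtain c where c: "\<And>i. i \<in> I \<Longrightarrow> (\<lambda>n. coord i (X n)) \<longlonglongrightarrow> c i" by metis
  have "(\<lambda>n. sqrt (\<Sum>i\<in>I. (cmod (coord i (X n) - c i))\<^sup>2)) \<longlonglongrightarrow> sqrt (\<Sum>i\<in>I. (cmod (c i - c i))\<^sup>2)"
    by (intro tendsto_intros c)
  moreover have "vnorm (X n - vec c) = sqrt (\<Sum>i\<in>I. (cmod (coord i (X n) - c i))\<^sup>2)" for n
    using X unfolding vnorm_eq by (intro arg_cong[where f = sqrt] sum.cong refl) (simp add: coord_diff coord_vec)
  ultimately show "\<exists>L\<in>W. (\<lambda>n. vnorm (X n - L)) \<longlonglongrightarrow> 0"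
    by (intro bexI[of _ "vec c"]) auto
qed (auto simp: subspace_W inner_product_on_W)

end

text \<open>Orthogonality of the characters of the cyclic group of order d; \<open>s\<close>
  contributes only a common phase. It yields the completeness of the shifted Fourier bases.\<close>

lemma sum_phase_eq:
  assumes "i < d" "j < d"
  shows "(\<Sum>k<d. cis (2 * pi * (real i - real j) * (real k + s) / real d)) = (if i = j then of_nat d else 0)"
proof (cases "i = j")
  case False
  have d: "real d > 0" using assms by simp
  define x where "x = real i - real j"
  define w where "w = cis (2 * pi * x / real d)"
  have "cis (2 * pi * x * (real k + s) / real d) = cis (2 * pi * x * s / real d) * w ^ k" for k
    unfolding w_def Complex.DeMoivre cis_mult
    using d by (intro arg_cong[where f = cis]) (simp add: field_simps)
  then have sum: "(\<Sum>k<d. cis (2 * pi * x * (real k + s) / real d)) = cis (2 * pi * x * s / real d) * (\<Sum>k<d. w ^ k)"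
    by (simp add: sum_distrib_left)
  have "w ^ d = cis (2 * pi * of_int (int i - int j))"
    unfolding w_def Complex.DeMoivre x_def using d by (intro arg_cong[where f = cis]) (simp add: field_simps)
  then have wd: "w ^ d = 1" by (simp only: cis_multiple_2pi Ints_of_int)
  have "w \<noteq> 1"
  proof
    assume "w = 1"
    then have "cos (2 * pi * x / real d) = 1" by (simp add: w_def complex_eq_iff)
    then obtain m :: int where "2 * pi * x / real d = of_int m * 2 * pi"
      by (auto simp: cos_one_2pi_int)
    then have "x = of_int m * real d" using d by (simp add: field_simps)
    then have "of_int (int i - int j) = (of_int (m * int d) :: real)" by (simp add: x_def)
    then have "int i - int j = m * int d" by (simp only: of_int_eq_iff)
    moreover have "\<bar>int i - int j\<bar> < int d" using assms by linarith
    ultimately have "\<bar>m * int d\<bar> < int d" by simp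
    then have "\<bar>m\<bar> * int d < 1 * int d" by (simp add: abs_mult)
    then have "\<bar>m\<bar> < 1" by (rule mult_right_less_imp_less) simp
    then show False using \<open>int i - int j = m * int d\<close> False by simp
  qed
  then have "(\<Sum>k<d. w ^ k) = 0" using geometric_sum[of w d] wd by simp
  then show ?thesis using sum False by (simp add: x_def)
qed simp

context finite_basis begin

lemma resolution_of_identity:
  assumes "\<And>i j. i \<in> I \<Longrightarrow> j \<in> I \<Longrightarrow> (\<Sum>k\<in>K. c k i * cnj (c k j)) = (if i = j then 1 else 0)"
    and x: "x \<in> W"
  shows "(\<Sum>k\<in>K. cip (vec (c k)) x *C vec (c k)) = x"
proof (rule W_eqI)
  fix i assume i: "i \<in> I"
  have "coord i (\<Sum>k\<in>K. cip (vec (c k)) x *C vec (c k)) = (\<Sum>k\<in>K. cip (vec (c k)) x * c k i)"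
    using i by (subst coord_sum) (auto simp: coord_scale coord_vec)
  also have "\<dots> = (\<Sum>k\<in>K. \<Sum>j\<in>I. coord j x * (c k i * cnj (c k j)))"
    by (simp add: cip_def coord_vec sum_distrib_left sum_distrib_right mult_ac)
  also have "\<dots> = (\<Sum>j\<in>I. coord j x * (\<Sum>k\<in>K. c k i * cnj (c k j)))"
    by (subst sum.swap) (simp add: sum_distrib_left)
  also have "\<dots> = (\<Sum>j\<in>I. if i = j then coord j x else 0)"
    using assms(1) i by (intro sum.cong refl) auto
  finally show "coord i (\<Sum>k\<in>K. cip (vec (c k)) x *C vec (c k)) = coord i x"
    using i finite_I by simp
qed (use x in auto)

end

context complex_vector_space begin

text \<open>The only use of the infinite dimension of the ambient space: it has independent families
  of every finite size.\<close>

lemma finite_basis_exists: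
  fixes I :: "'i set"
  assumes inf: "\<forall>S. finite S \<longrightarrow> span S \<noteq> UNIV" and "finite I"
  shows "\<exists>b. finite_basis scale I b"
proof -
  obtain B where B: "independent B" "span B = UNIV"
    by (rule maximal_independent_subset[of UNIV]) auto
  have "infinite B" using inf B by blast
  then obtain S where S: "finite S" "card S = card I" "S \<subseteq> B"
    using infinite_arbitrarily_large by blast
  obtain b where b: "bij_betw b I S"
    using finite_same_card_bij[OF assms(2) S(1)] S(2) by auto
  have "finite_basis scale I b"
    using b assms(2) independent_mono[OF B(1) S(3)]
    by unfold_locales (auto simp: bij_betw_def)
  then show ?thesis by blast
qed

text \<open>The factors and the product need not be related inside the ambient space. Any
  independent family indexed by pairs can play the role of the products of basis vectors, since
  \<open>\<tau>\<close> is defined through coordinates.\<close>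

lemma tensor_product_coordinates:
  assumes "finite_basis scale I e" and "finite_basis scale (I \<times> I) f"
  defines "WA \<equiv> finite_basis.W scale I e" and "ipA \<equiv> finite_basis.cip scale I e"
    and "W \<equiv> finite_basis.W scale (I \<times> I) f" and "ip \<equiv> finite_basis.cip scale (I \<times> I) f"
    and "\<tau> \<equiv> (\<lambda>x y. finite_basis.vec scale (I \<times> I) f
      (\<lambda>(i, j). finite_basis.coord scale I e i x * finite_basis.coord scale I e j y))"
  shows "tensor_product WA ipA WA ipA W ip \<tau>"
proof -
  interpret E: finite_basis scale I e by (rule assms(1))
  interpret F: finite_basis scale "I \<times> I" f by (rule assms(2))
  have coord\<tau>: "F.coord (i, j) (\<tau> x y) = E.coord i x * E.coord j y" if "i \<in> I" "j \<in> I" for i j x y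
    using that by (simp add: \<tau>_def F.coord_vec)
  have \<tau>W: "\<tau> x y \<in> F.W" for x y by (simp add: \<tau>_def)
  have F_scaleW: "c *C x \<in> F.W" if "x \<in> F.W" for c x
    using that by (rule subspace_scale[OF F.subspace_W])
  have F_addW: "x + y \<in> F.W" if "x \<in> F.W" "y \<in> F.W" for x y
    using that by (rule subspace_add[OF F.subspace_W])
  have "dense_span F.W F.cip {\<tau> x y |x y. x \<in> E.W \<and> y \<in> E.W}"
    unfolding dense_span_def
  proof (intro conjI ballI allI impI)
    show "{\<tau> x y |x y. x \<in> E.W \<and> y \<in> E.W} \<subseteq> F.W" using \<tau>W by auto
    fix z and \<epsilon> :: real assume z: "z \<in> F.W" and \<epsilon>: "\<epsilon> > 0"
    have "f p \<in> {\<tau> x y |x y. x \<in> E.W \<and> y \<in> E.W}" if p: "p \<in> I \<times> I" for p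
    proof -
      obtain i j where ij: "p = (i, j)" "i \<in> I" "j \<in> I" using p by auto
      have "\<tau> (e i) (e j) = f (i, j)"
        using ij by (intro F.W_eqI \<tau>W F.b_in_W) (auto simp: coord\<tau> E.coord_b F.coord_b split: if_splits)
      then show ?thesis unfolding ij(1) using E.b_in_W[OF ij(2)] E.b_in_W[OF ij(3)]
        by (smt (verit) mem_Collect_eq)
    qed
    then have "span (f ` (I \<times> I)) \<subseteq> span {\<tau> x y |x y. x \<in> E.W \<and> y \<in> E.W}"
      by (intro span_mono) auto
    then have "z \<in> span {\<tau> x y |x y. x \<in> E.W \<and> y \<in> E.W}"
      using z by (auto simp: F.W_def)
    then show "\<exists>y\<in>span {\<tau> x y |x y. x \<in> E.W \<and> y \<in> E.W}. F.vnorm (z - y) < \<epsilon>"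
      using \<epsilon> by (intro bexI[of _ z]) auto
  qed
  moreover have "F.cip (\<tau> x y) (\<tau> x' y') = E.cip x x' * E.cip y y'" for x x' y y'
  proof -
    have "F.cip (\<tau> x y) (\<tau> x' y') =
        (\<Sum>i\<in>I. \<Sum>j\<in>I. cnj (E.coord i x * E.coord j y) * (E.coord i x' * E.coord j y'))"
      unfolding F.cip_def sum.cartesian_product by (intro sum.cong refl) (auto simp: coord\<tau>)
    then show ?thesis by (simp add: E.cip_def sum_product mult_ac)
  qed
  moreover have "\<tau> (x + x') y = \<tau> x y + \<tau> x' y" if "x \<in> E.W" "x' \<in> E.W" for x x' y
    by (rule F.W_eqI) (use that in \<open>auto simp: coord\<tau> \<tau>W F_addW F.coord_add E.coord_add distrib_right\<close>)
  moreover have "\<tau> x (y + y') = \<tau> x y + \<tau> x y'" if "y \<in> E.W" "y' \<in> E.W" for x y y'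
    by (rule F.W_eqI) (use that in \<open>auto simp: coord\<tau> \<tau>W F_addW F.coord_add E.coord_add distrib_left\<close>)
  moreover have "\<tau> (c *C x) y = c *C \<tau> x y" if "x \<in> E.W" for c x y
    by (rule F.W_eqI) (use that in \<open>auto simp: coord\<tau> \<tau>W F_scaleW F.coord_scale E.coord_scale\<close>)
  moreover have "\<tau> x (c *C y) = c *C \<tau> x y" if "y \<in> E.W" for c x y
    by (rule F.W_eqI) (use that in \<open>auto simp: coord\<tau> \<tau>W F_scaleW F.coord_scale E.coord_scale\<close>)
  ultimately show ?thesis
    unfolding tensor_product_def WA_def ipA_def W_def ip_def
    using F.hilbert_space_W by simp
qed

lemma quantum_behavior_fourier:
  assumes inf: "\<forall>S. finite S \<longrightarrow> span S \<noteq> UNIV"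
    and norm: "(\<Sum>j<d. (\<alpha> j)\<^sup>2) = 1"
  shows "quantum_behavior d (fourier_behavior d \<alpha>)"
proof -
  obtain e where e: "finite_basis scale {..<d} e" using finite_basis_exists[OF inf] by blast
  obtain f where f: "finite_basis scale ({..<d} \<times> {..<d}) f"
    using finite_basis_exists[OF inf, of "{..<d} \<times> {..<d}"] by blast
  interpret E: finite_basis scale "{..<d}" e by (rule e)
  interpret F: finite_basis scale "{..<d} \<times> {..<d}" f by (rule f)
  define \<tau> where "\<tau> = (\<lambda>x y. F.vec (\<lambda>(i, j). E.coord i x * E.coord j y))"
  have tp: "tensor_product E.W E.cip E.W E.cip F.W F.cip \<tau>"
    unfolding \<tau>_def by (rule tensor_product_coordinates[OF e f])
  define \<psi> where "\<psi> = F.vec (\<lambda>(i, j). if i = j then of_real (\<alpha> i) else 0)"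
  \<comment> \<open>Opposite signs in the exponents of \<open>cu\<close> and \<open>cv\<close> make
    the product of their conjugates depend on \<open>k - l\<close>; for the same reason
    \<open>bob_shift\<close> is subtracted from \<open>l\<close>. Only equal indices survive against
    \<open>\<psi>\<close>.\<close>
  define cu where "cu a k j = cis (- (2 * pi * real j * (real k + alice_shift a) / real d)) / sqrt (real d)" for a k j :: nat
  define cv where "cv b l j = cis (2 * pi * real j * (real l - bob_shift b) / real d) / sqrt (real d)" for b l j :: nat
  have sq: "complex_of_real (sqrt (real d)) * complex_of_real (sqrt (real d)) = of_nat d"
    by (simp flip: of_real_mult)
  show ?thesis
  proof (rule quantum_behavior_rank_one[OF E.hilbert_space_W E.hilbert_space_W tp])
    show "\<psi> \<in> F.W" by (simp add: \<psi>_def)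
    have "F.cip \<psi> \<psi> = (\<Sum>i<d. \<Sum>j<d. if j = i then of_real ((\<alpha> i)\<^sup>2) else 0)"
      unfolding F.cip_def sum.cartesian_product
      by (intro sum.cong refl) (auto simp: \<psi>_def F.coord_vec power2_eq_square)
    also have "\<dots> = of_real (\<Sum>i<d. (\<alpha> i)\<^sup>2)" by simp
    finally show "F.cip \<psi> \<psi> = 1" by (simp add: norm)
    show "E.vec (cu a k) \<in> E.W" "E.vec (cv a k) \<in> E.W" for a k by simp_all
    show "(\<Sum>k<d. E.cip (E.vec (cu a k)) x *C E.vec (cu a k)) = x" if "x \<in> E.W" for a x
    proof (rule E.resolution_of_identity[OF _ that])
      fix i j assume ij: "i \<in> {..<d}" "j \<in> {..<d}"
      have "cu a k i * cnj (cu a k j) =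
          cis (2 * pi * (real j - real i) * (real k + alice_shift a) / real d) / of_nat d" for k
        by (simp add: cu_def cis_cnj cis_mult sq) (simp add: algebra_simps diff_divide_distrib add_divide_distrib)
      then show "(\<Sum>k<d. cu a k i * cnj (cu a k j)) = (if i = j then 1 else 0)"
        using sum_phase_eq[of j d i "alice_shift a"] ij by (auto simp flip: sum_divide_distrib)
    qed
    show "(\<Sum>k<d. E.cip (E.vec (cv a k)) x *C E.vec (cv a k)) = x" if "x \<in> E.W" for a x
    proof (rule E.resolution_of_identity[OF _ that])
      fix i j assume ij: "i \<in> {..<d}" "j \<in> {..<d}"
      have "cv a k i * cnj (cv a k j) =
          cis (2 * pi * (real i - real j) * (real k + (- bob_shift a)) / real d) / of_nat d" for k
        by (simp add: cv_def cis_cnj cis_mult sq) (simp add: algebra_simps diff_divide_distrib add_divide_distrib)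
      then show "(\<Sum>k<d. cv a k i * cnj (cv a k j)) = (if i = j then 1 else 0)"
        using sum_phase_eq[of i d j "- bob_shift a"] ij by (auto simp flip: sum_divide_distrib)
    qed
    show "fourier_behavior d \<alpha> k l a b = (cmod (F.cip (\<tau> (E.vec (cu a k)) (E.vec (cv b l))) \<psi>))\<^sup>2" for k l a b
    proof -
      have prod: "cnj (cu a k j) * cnj (cv b l j) =
          cis (2 * pi * real j * (real k - real l + alice_shift a + bob_shift b) / real d) / of_nat d" for j
        by (simp add: cu_def cv_def cis_cnj cis_mult sq) (simp add: algebra_simps diff_divide_distrib add_divide_distrib)
      have "F.cip (\<tau> (E.vec (cu a k)) (E.vec (cv b l))) \<psi> =
          (\<Sum>i<d. \<Sum>j<d. if j = i then cnj (cu a k i * cv b l i) * of_real (\<alpha> i) else 0)"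
        unfolding F.cip_def sum.cartesian_product
        by (intro sum.cong refl) (auto simp: \<psi>_def \<tau>_def F.coord_vec E.coord_vec)
      also have "\<dots> = (\<Sum>j<d. of_real (\<alpha> j) *
          cis (2 * pi * real j * (real k - real l + alice_shift a + bob_shift b) / real d)) / of_nat d"
        by (simp add: prod sum_divide_distrib mult.commute)
      finally show ?thesis
        by (simp add: fourier_behavior_def norm_divide power_divide)
    qed
  qed
qed

lemma exists_small_bell_value:
  assumes "\<forall>S. finite S \<longrightarrow> span S \<noteq> UNIV" "d \<ge> 2"
  shows "\<exists>P. quantum_behavior d P \<and> bell_value d P \<le> 20 / (pi * harm (d div 2))"
proof -
  have "d div 2 \<ge> 1" using assms(2) by linarith
  then obtain \<alpha> where "(\<Sum>j<d. (\<alpha> j)\<^sup>2) = 1"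
    "bell_value d (fourier_behavior d \<alpha>) \<le> 20 / (pi * harm (d div 2))"
    using fourier_bell_value_small[of "d div 2" d] by auto
  then show ?thesis using quantum_behavior_fourier[OF assms(1)] by blast
qed

end

section \<open>The limit of the minimal values\<close>

lemma bell_bound_tendsto: "(\<lambda>d. 20 / (pi * harm (d div 2))) \<longlonglongrightarrow> (0::real)"
proof -
  have "filterlim (\<lambda>d. harm (d div 2) :: real) at_top sequentially"
    by (rule filterlim_compose[OF harm_at_top filterlim_at_top_div_const_nat]) simp
  then have "filterlim (\<lambda>d. pi * harm (d div 2)) at_top sequentially"
    by (rule filterlim_tendsto_pos_mult_at_top[OF tendsto_const pi_gt_zero])
  then show ?thesis
    by (rule tendsto_divide_0[OF tendsto_const filterlim_at_top_imp_at_infinity])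
qed

theorem mainTheorem1:
  fixes scale :: "complex \<Rightarrow> 'v::ab_group_add \<Rightarrow> 'v"
  assumes "complex_vector_space scale"
    and infinite_dim: "\<forall>S. finite S \<longrightarrow> module.span scale S \<noteq> UNIV"
  shows "(complex_vector_space.quantum_min scale \<longlonglongrightarrow> 0) \<and>
    (\<forall>d\<ge>2. \<forall>P. complex_vector_space.quantum_behavior scale d P \<longrightarrow> bell_value d P \<ge> 0) \<and>
    (\<forall>c>0. \<exists>d\<ge>2. \<exists>P. complex_vector_space.quantum_behavior scale d P \<and> bell_value d P < c)"
proof -
  interpret complex_vector_space scale by (rule assms(1))
  note small = exists_small_bell_value[OF infinite_dim]
  have "quantum_min \<longlonglongrightarrow> 0"
  proof (rule tendsto_sandwich[OF _ _ tendsto_const bell_bound_tendsto])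
    have "0 \<le> quantum_min d \<and> quantum_min d \<le> 20 / (pi * harm (d div 2))" if d: "d \<ge> 2" for d
    proof -
      define S where "S = {bell_value d P | P. quantum_behavior d P}"
      have S0: "x \<ge> 0" if "x \<in> S" for x using that bell_value_nonneg by (auto simp: S_def)
      obtain P where P: "quantum_behavior d P" "bell_value d P \<le> 20 / (pi * harm (d div 2))"
        using small[OF d] by blast
      \<comment> \<open>The witness also shows that \<open>S\<close> is nonempty, without which
        \<open>Inf S\<close> could not be bounded from below by 0.\<close>
      have "bell_value d P \<in> S" using P(1) by (auto simp: S_def)
      moreover have "bdd_below S" using S0 by (intro bdd_belowI)
      ultimately have "Inf S \<le> bell_value d P" "Inf S \<ge> 0"
        using S0 by (auto intro: cInf_lower cInf_greatest)
      then show ?thesis using P(2) by (simp add: quantum_min_def S_def)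
    qed
    then show "\<forall>\<^sub>F d in sequentially. 0 \<le> quantum_min d"
      "\<forall>\<^sub>F d in sequentially. quantum_min d \<le> 20 / (pi * harm (d div 2))"
      by (auto intro: eventually_sequentiallyI)
  qed
  moreover have "\<exists>d\<ge>2. \<exists>P. quantum_behavior d P \<and> bell_value d P < c" if c: "c > 0" for c
  proof -
    have "\<forall>\<^sub>F d in sequentially. 20 / (pi * harm (d div 2)) < c \<and> d \<ge> 2"
      using order_tendstoD(2)[OF bell_bound_tendsto c] eventually_ge_at_top[of 2] by eventually_elim simp
    then obtain d where d: "20 / (pi * harm (d div 2)) < c" "d \<ge> 2"
      by (auto simp: eventually_sequentially)
    then show ?thesis using small[OF d(2)] by force
  qed
  ultimately show ?thesis using bell_value_nonneg by blast
qed

end
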